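(* Let $\Sigma=\langle\mathcal{I},\preceq,\mathcal{W},\mathcal{C},\mathcal{E}\rangle$ be a subexponential signature with $\mathcal{C}\neq\varnothing$. Then the derivability problem in $\mathrm{SLC}_\Sigma$ is undecidable.
   Context: A subexponential signature is $\Sigma = \langle \mathcal{I}, \preceq, \mathcal{W}, \mathcal{C}, \mathcal{E}\rangle$ with $\mathcal{I}$ a finite set of labels, $\preceq$ a preorder, $\mathcal{W},\mathcal{C},\mathcal{E}\subseteq\mathcal{I}$ upwardly closed w.r.t. $\preceq$, and $\mathcal{W}\cap\mathcal{C}\subseteq\mathcal{E}$. $\mathrm{SLC}_\Sigma$: formulae built from variables $p_1,p_2,\dots$ using $\cdot,\backslash,/$ and ${!}^s$ ($s\in\mathcal{I}$) (no constants); sequents $\Gamma\to C$ with $\Gamma$ a finite, possibly empty, sequence. Rules (cut-free; premises / conclusion): $A\to A$; $\Gamma_1,A,B,\Gamma_2\to C\ /\ \Gamma_1,A\cdot B,\Gamma_2\to C$; $\Gamma_1\to A$, $\Gamma_2\to B\ /\ \Gamma_1,\Gamma_2\to A\cdot B$; $\Pi\to A$, $\Gamma_1,B,\Gamma_2\to C\ /\ \Gamma_1,\Pi,A\backslash B,\Gamma_2\to C$; $A,\Pi\to B\ /\ \Pi\to A\backslash B$; $\Pi\to A$, $\Gamma_1,B,\Gamma_2\to C\ /\ \Gamma_1,B/A,\Pi,\Gamma_2\to C$; $\Pi,A\to B\ /\ \Pi\to B/A$; $\Gamma_1,A,\Gamma_2\to C\ /\ \Gamma_1,{!}^sA,\Gamma_2\to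 C$; ${!}^{s_1}A_1,\dots,{!}^{s_n}A_n\to B\ /\ {!}^{s_1}A_1,\dots,{!}^{s_n}A_n\to{!}^sB$ if $s\preceq s_j$ for all $j$; for $s\in\mathcal{W}$: $\Gamma_1,\Gamma_2\to C\ /\ \Gamma_1,{!}^sA,\Gamma_2\to C$; for $s\in\mathcal{C}$ (non-local contraction): $\Gamma_1,{!}^sA,\Delta,{!}^sA,\Gamma_2\to C\ /\ \Gamma_1,{!}^sA,\Delta,\Gamma_2\to C$ and $/\ \Gamma_1,\Delta,{!}^sA,\Gamma_2\to C$; for $s\in\mathcal{E}$: $\Gamma_1,\Delta,{!}^sA,\Gamma_2\to C\ /\ \Gamma_1,{!}^sA,\Delta,\Gamma_2\to C$ and $\Gamma_1,{!}^sA,\Delta,\Gamma_2\to C\ /\ \Gamma_1,\Delta,{!}^sA,\Gamma_2\to C$. *)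

theory Defs
  imports Main "HOL-Library.Nat_Bijection"
begin

section \<open>Subexponential signatures and formulae\<close>

record 's subexp_sig =
  labels :: "'s set"
  leq :: "'s rel"
  weak :: "'s set"
  contr :: "'s set"
  exch :: "'s set"

definition up_closed :: "'s subexp_sig \<Rightarrow> 's set \<Rightarrow> bool" where
  "up_closed \<Sigma> U \<longleftrightarrow> U \<subseteq> labels \<Sigma> \<and> (\<forall>s t. s \<in> U \<and> (s, t) \<in> leq \<Sigma> \<longrightarrow> t \<in> U)"

definition subexp_signature :: "'s subexp_sig \<Rightarrow> bool" where
  "subexp_signature \<Sigma> \<longleftrightarrow>
     finite (labels \<Sigma>) \<and> preorder_on (labels \<Sigma>) (leq \<Sigma>) \<and>
     up_closed \<Sigma> (weak \<Sigma>) \<and> up_closed \<Sigma> (contr \<Sigma>) \<and> up_closed \<Sigma> (exch \<Sigma>) \<and>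
     weak \<Sigma> \<inter> contr \<Sigma> \<subseteq> exch \<Sigma>"

text \<open>\<open>LDiv A B\<close> is $A \backslash B$ and \<open>RDiv B A\<close> is $B / A$:
  the arguments occur in the order in which they are written.\<close>

datatype 's fm =
    Var nat
  | Prod "'s fm" "'s fm"
  | LDiv "'s fm" "'s fm"
  | RDiv "'s fm" "'s fm"
  | Bang 's "'s fm"

definition formulae :: "'s subexp_sig \<Rightarrow> 's fm set" where
  "formulae \<Sigma> = {A. set_fm A \<subseteq> labels \<Sigma>}"

type_synonym 's sequent = "'s fm list \<times> 's fm"

definition sequents :: "'s subexp_sig \<Rightarrow> 's sequent set" where
  "sequents \<Sigma> = {(\<Gamma>, C). set \<Gamma> \<subseteq> formulae \<Sigma> \<and> C \<in> formulae \<Sigma>}"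

section \<open>The cut-free calculus\<close>

text \<open>Side conditions on \<open>labels\<close> and \<open>formulae\<close> are imposed exactly in the rules that introduce
  a label or a formula not occurring in a premise, so that all derivable sequents are in the
  language of the signature.\<close>

inductive derivable :: "'s subexp_sig \<Rightarrow> 's fm list \<Rightarrow> 's fm \<Rightarrow> bool" for \<Sigma> where
  Ax: "A \<in> formulae \<Sigma> \<Longrightarrow> derivable \<Sigma> [A] A"
| ProdL: "derivable \<Sigma> (\<Gamma>1 @ [A, B] @ \<Gamma>2) C \<Longrightarrow> derivable \<Sigma> (\<Gamma>1 @ [Prod A B] @ \<Gamma>2) C"
| ProdR: "derivable \<Sigma> \<Gamma>1 A \<Longrightarrow> derivable \<Sigma> \<Gamma>2 B \<Longrightarrow> derivable \<Sigma> (\<Gamma>1 @ \<Gamma>2) (Prod A B)"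
| LDivL: "derivable \<Sigma> \<Pi> A \<Longrightarrow> derivable \<Sigma> (\<Gamma>1 @ [B] @ \<Gamma>2) C \<Longrightarrow>
    derivable \<Sigma> (\<Gamma>1 @ \<Pi> @ [LDiv A B] @ \<Gamma>2) C"
| LDivR: "derivable \<Sigma> ([A] @ \<Pi>) B \<Longrightarrow> derivable \<Sigma> \<Pi> (LDiv A B)"
| RDivL: "derivable \<Sigma> \<Pi> A \<Longrightarrow> derivable \<Sigma> (\<Gamma>1 @ [B] @ \<Gamma>2) C \<Longrightarrow>
    derivable \<Sigma> (\<Gamma>1 @ [RDiv B A] @ \<Pi> @ \<Gamma>2) C"
| RDivR: "derivable \<Sigma> (\<Pi> @ [A]) B \<Longrightarrow> derivable \<Sigma> \<Pi> (RDiv B A)"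
| BangL: "s \<in> labels \<Sigma> \<Longrightarrow> derivable \<Sigma> (\<Gamma>1 @ [A] @ \<Gamma>2) C \<Longrightarrow>
    derivable \<Sigma> (\<Gamma>1 @ [Bang s A] @ \<Gamma>2) C"
| BangR: "s \<in> labels \<Sigma> \<Longrightarrow> \<forall>(t, A) \<in> set \<Delta>. (s, t) \<in> leq \<Sigma> \<Longrightarrow>
    derivable \<Sigma> (map (\<lambda>(t, A). Bang t A) \<Delta>) B \<Longrightarrow>
    derivable \<Sigma> (map (\<lambda>(t, A). Bang t A) \<Delta>) (Bang s B)"
| Weak: "s \<in> weak \<Sigma> \<Longrightarrow> A \<in> formulae \<Sigma> \<Longrightarrow> derivable \<Sigma> (\<Gamma>1 @ \<Gamma>2) C \<Longrightarrow>
    derivable \<Sigma> (\<Gamma>1 @ [Bang s A] @ \<Gamma>2) C"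
| Contr1: "s \<in> contr \<Sigma> \<Longrightarrow> derivable \<Sigma> (\<Gamma>1 @ [Bang s A] @ \<Delta> @ [Bang s A] @ \<Gamma>2) C \<Longrightarrow>
    derivable \<Sigma> (\<Gamma>1 @ [Bang s A] @ \<Delta> @ \<Gamma>2) C"
| Contr2: "s \<in> contr \<Sigma> \<Longrightarrow> derivable \<Sigma> (\<Gamma>1 @ [Bang s A] @ \<Delta> @ [Bang s A] @ \<Gamma>2) C \<Longrightarrow>
    derivable \<Sigma> (\<Gamma>1 @ \<Delta> @ [Bang s A] @ \<Gamma>2) C"
| Exch1: "s \<in> exch \<Sigma> \<Longrightarrow> derivable \<Sigma> (\<Gamma>1 @ \<Delta> @ [Bang s A] @ \<Gamma>2) C \<Longrightarrow>
    derivable \<Sigma> (\<Gamma>1 @ [Bang s A] @ \<Delta> @ \<Gamma>2) C"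
| Exch2: "s \<in> exch \<Sigma> \<Longrightarrow> derivable \<Sigma> (\<Gamma>1 @ [Bang s A] @ \<Delta> @ \<Gamma>2) C \<Longrightarrow>
    derivable \<Sigma> (\<Gamma>1 @ \<Delta> @ [Bang s A] @ \<Gamma>2) C"

lemma derivable_sequents:
  assumes "subexp_signature \<Sigma>" and "derivable \<Sigma> \<Gamma> C"
  shows "(\<Gamma>, C) \<in> sequents \<Sigma>"
  using assms(2,1)
  by induction
    (auto simp: sequents_def formulae_def subexp_signature_def up_closed_def)

section \<open>Partial recursive functions and decidability\<close>

text \<open>Arities are not recorded in the terms: a term is evaluated on argument lists, and \<open>Zero\<close>
  stands for the zero function of every arity. In \<open>PrimRec f g\<close> the first argument is the
  recursion argument, and \<open>g\<close> receives the predecessor, the previous value and the parameters.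
  \<open>Mu f\<close> is unbounded minimisation over the first argument of \<open>f\<close>; it has a value only if \<open>f\<close> is
  defined at all smaller arguments.\<close>

datatype recf =
    Zero
  | Succ
  | Proj nat
  | Comp recf "recf list"
  | PrimRec recf recf
  | Mu recf

inductive rec_eval :: "recf \<Rightarrow> nat list \<Rightarrow> nat \<Rightarrow> bool" where
  rec_Zero: "rec_eval Zero xs 0"
| rec_Succ: "rec_eval Succ [x] (Suc x)"
| rec_Proj: "i < length xs \<Longrightarrow> rec_eval (Proj i) xs (xs ! i)"
| rec_Comp: "list_all2 (\<lambda>g y. rec_eval g xs y) gs ys \<Longrightarrow> rec_eval f ys z \<Longrightarrow>
    rec_eval (Comp f gs) xs z"
| rec_PrimRec_0: "rec_eval f xs y \<Longrightarrow> rec_eval (PrimRec f g) (0 # xs) y"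
| rec_PrimRec_Suc: "rec_eval (PrimRec f g) (n # xs) y \<Longrightarrow> rec_eval g (n # y # xs) z \<Longrightarrow>
    rec_eval (PrimRec f g) (Suc n # xs) z"
| rec_Mu: "\<forall>m<n. \<exists>k. rec_eval f (m # xs) (Suc k) \<Longrightarrow> rec_eval f (n # xs) 0 \<Longrightarrow>
    rec_eval (Mu f) xs n"

lemma rec_eval_deterministic:
  "rec_eval f xs y \<Longrightarrow> rec_eval f xs y' \<Longrightarrow> y = y'"
proof (induction arbitrary: y' rule: rec_eval.induct)
  case (rec_Comp xs gs ys f z)
  from rec_Comp.prems obtain ys' where
    ys': "list_all2 (\<lambda>g y. rec_eval g xs y) gs ys'" and z: "rec_eval f ys' y'"
    by cases
  have "ys = ys'"
    using rec_Comp.IH(1) ys' by (auto simp: list_all2_conv_all_nth intro!: nth_equalityI)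
  with z rec_Comp.IH(2) show ?case by blast
next
  case (rec_Mu n f xs)
  from rec_Mu.prems have
    below: "\<forall>m<y'. \<exists>k. rec_eval f (m # xs) (Suc k)" and zero: "rec_eval f (y' # xs) 0"
    by (cases; simp)+
  have "\<not> y' < n" using rec_Mu.IH(1) zero by force
  moreover have "\<not> n < y'" using rec_Mu.IH(2) below by force
  ultimately show ?case by simp
next
  case (rec_PrimRec_Suc f g n xs y z)
  from rec_PrimRec_Suc.prems show ?case
    by cases (use rec_PrimRec_Suc.IH in blast)
qed (erule rec_eval.cases; fastforce)+

text \<open>The decision problem \<open>P\<close> on the instances \<open>X\<close>, presented through the numbering \<open>enc\<close>. The
  deciding function has to be correct on numbers of instances only.\<close>

definition decidable_problem :: "('a \<Rightarrow> nat) \<Rightarrow> 'a set \<Rightarrow> ('a \<Rightarrow> bool) \<Rightarrow> bool" where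
  "decidable_problem enc X P \<longleftrightarrow>
     (\<exists>f. \<forall>x\<in>X. rec_eval f [enc x] (if P x then 1 else 0))"

section \<open>The derivability problem\<close>

fun fm_encode :: "('s \<Rightarrow> nat) \<Rightarrow> 's fm \<Rightarrow> nat" where
  "fm_encode l (Var n) = prod_encode (0, n)"
| "fm_encode l (Prod A B) = prod_encode (1, prod_encode (fm_encode l A, fm_encode l B))"
| "fm_encode l (LDiv A B) = prod_encode (2, prod_encode (fm_encode l A, fm_encode l B))"
| "fm_encode l (RDiv A B) = prod_encode (3, prod_encode (fm_encode l A, fm_encode l B))"
| "fm_encode l (Bang s A) = prod_encode (4, prod_encode (l s, fm_encode l A))"

definition sequent_encode :: "('s \<Rightarrow> nat) \<Rightarrow> 's sequent \<Rightarrow> nat" where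
  "sequent_encode l = (\<lambda>(\<Gamma>, C). prod_encode (list_encode (map (fm_encode l) \<Gamma>), fm_encode l C))"

lemma inj_on_fm_encode:
  assumes "inj_on l (labels \<Sigma>)"
  shows "inj_on (fm_encode l) (formulae \<Sigma>)"
proof -
  have "fm_encode l A = fm_encode l B \<Longrightarrow> A = B"
    if "A \<in> formulae \<Sigma>" "B \<in> formulae \<Sigma>" for A B
    using that
  proof (induction A arbitrary: B)
    case (Var n) then show ?case by (cases B) auto
  next
    case (Prod A1 A2) then show ?case by (cases B) (auto simp: formulae_def)
  next
    case (LDiv A1 A2) then show ?case by (cases B) (auto simp: formulae_def)
  next
    case (RDiv A1 A2) then show ?case by (cases B) (auto simp: formulae_def)
  next
    case (Bang s A) then show ?case
      using assms by (cases B) (auto simp: formulae_def dest: inj_onD)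
  qed
  then show ?thesis by (auto intro: inj_onI)
qed

lemma inj_on_sequent_encode:
  assumes "inj_on l (labels \<Sigma>)"
  shows "inj_on (sequent_encode l) (sequents \<Sigma>)"
proof (rule inj_onI, clarify)
  fix \<Gamma> C \<Delta> D
  assume *: "(\<Gamma>, C) \<in> sequents \<Sigma>" "(\<Delta>, D) \<in> sequents \<Sigma>"
    "sequent_encode l (\<Gamma>, C) = sequent_encode l (\<Delta>, D)"
  then have "map (fm_encode l) \<Gamma> = map (fm_encode l) \<Delta>" "fm_encode l C = fm_encode l D"
    by (auto simp: sequent_encode_def list_encode_eq)
  moreover have "inj_on (fm_encode l) (set \<Gamma> \<union> set \<Delta>)"
    using * inj_on_fm_encode[OF assms] by (auto simp: sequents_def intro: inj_on_subset)
  ultimately show "\<Gamma> = \<Delta> \<and> C = D"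
    using * inj_on_fm_encode[OF assms]
    by (auto simp: sequents_def dest: inj_onD map_inj_on)
qed

text \<open>Since the set of labels is finite, the choice of the numbering \<open>l\<close> of the labels is
  immaterial; undecidability is to be shown for all of them.\<close>

definition decidable_derivability :: "'s subexp_sig \<Rightarrow> bool" where
  "decidable_derivability \<Sigma> \<longleftrightarrow>
     (\<exists>l. inj_on l (labels \<Sigma>) \<and>
        decidable_problem (sequent_encode l) (sequents \<Sigma>) (\<lambda>(\<Gamma>, C). derivable \<Sigma> \<Gamma> C))"

end

theory Submission
  imports Defs "HOL-Library.Countable"
begin

text \<open>Diagonalisation, without a universal machine. Every recursive function is compiled to a
  deterministic string rewriting system, whose rules \<open>u \<Rightarrow> v\<close> become formulae \<open>!(u \ v)\<close> at the right
  end of a sequent; non-local contraction copies them to where they are applied. Such a sequent is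
  a word for the input \<open>n\<close> followed by a fixed list of formulae that describes the program, and its
  code is computable from \<open>n\<close> and the code of this list. Given a decider, compile the function that
  applies it to the sequent in which the input \<open>n\<close> is itself the code of the list: running this
  program on its own list accepts iff the resulting sequent is not derivable. As the computation
  terminates, determinism of the rewriting is enough to exclude acceptance in the other case.\<close>

section \<open>Compiling recursive functions to counter programs\<close>

datatype instr = Inc nat | While nat "instr list"

text \<open>Entering a loop unfolds it into program text, so the program still to be run is the
  whole control state. No program counter is needed, and the heads of the rewriting system can carry
  the same programs.\<close>

inductive run :: "instr list \<Rightarrow> (nat \<Rightarrow> nat) \<Rightarrow> (nat \<Rightarrow> nat) \<Rightarrow> bool" where
  run_Nil: "run [] R R"
| run_Inc: "run c (R(i := Suc (R i))) R' \<Longrightarrow> run (Inc i # c) R R'"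
| run_While_0: "R i = 0 \<Longrightarrow> run c R R' \<Longrightarrow> run (While i b # c) R R'"
| run_While_Suc: "R i = Suc n \<Longrightarrow> run (b @ While i b # c) (R(i := n)) R' \<Longrightarrow> run (While i b # c) R R'"

section \<open>Runs of basic counter programs\<close>

lemma run_append: "run p R R' \<Longrightarrow> run q R' R'' \<Longrightarrow> run (p @ q) R R''"
  by (induction rule: run.induct) (auto intro: run.intros)

lemma run_single: "run [Inc i] R (R(i := Suc (R i)))"
  by (intro run_Inc run_Nil)

lemma run_loop:
  assumes "R i = Suc n" "run b (R(i := n)) R1" "run [While i b] R1 R2"
  shows "run [While i b] R R2"
  using run_While_Suc[where c="[]"] run_append assms by blast

lemma run_loop_exit: "R i = 0 \<Longrightarrow> run [While i b] R R"
  by (simp add: run_While_0 run_Nil)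

lemma run_clear: "run [While i []] R (R(i := 0))"
proof (induction "R i" arbitrary: R)
  case 0
  then show ?case by (metis fun_upd_triv run_loop_exit)
next
  case (Suc n)
  have "run [While i []] (R(i := n)) (R(i := 0))"
    using Suc.hyps(1)[of "R(i := n)"] by simp
  then show ?case using Suc.hyps(2) by (metis run_loop run_Nil)
qed

lemma run_clear_all: "run (map (\<lambda>i. While i []) is) R (\<lambda>j. if j \<in> set is then 0 else R j)"
proof (induction "is" arbitrary: R)
  case Nil
  then show ?case by (simp add: run_Nil)
next
  case (Cons i "is")
  have "(\<lambda>j. if j \<in> set is then 0 else (R(i := 0)) j) = (\<lambda>j. if j \<in> set (i # is) then 0 else R j)"
    by auto
  with run_append[OF run_clear Cons.IH, of i R] show ?case by simp
qed

lemma run_move: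
  assumes "i \<noteq> d"
  shows "run [While i [Inc d]] R (R(i := 0, d := R d + R i))"
proof (induction "R i" arbitrary: R)
  case 0
  then have "R(i := 0, d := R d + R i) = R" using assms by auto
  then show ?case using 0 by (metis run_loop_exit)
next
  case (Suc n)
  let ?R = "R(i := n, d := Suc (R d))"
  have "run [While i [Inc d]] ?R (R(i := 0, d := R d + R i))"
    using Suc.hyps(1)[of ?R] assms by (simp add: fun_upd_twist flip: Suc.hyps(2))
  moreover have "run [Inc d] (R(i := n)) ?R"
    using run_single[of d "R(i := n)"] assms by simp
  ultimately show ?case using Suc.hyps(2) by (metis run_loop)
qed

lemma run_move_2:
  assumes "i \<noteq> d" "i \<noteq> e" "d \<noteq> e"
  shows "run [While i [Inc d, Inc e]] R (R(i := 0, d := R d + R i, e := R e + R i))"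
proof (induction "R i" arbitrary: R)
  case 0
  then have "R(i := 0, d := R d + R i, e := R e + R i) = R" using assms by auto
  then show ?case using 0 by (metis run_loop_exit)
next
  case (Suc n)
  let ?R = "R(i := n, d := Suc (R d), e := Suc (R e))"
  have "?R(i := 0, d := ?R d + ?R i, e := ?R e + ?R i) = R(i := 0, d := R d + R i, e := R e + R i)"
    using Suc.hyps(2) assms by auto
  then have "run [While i [Inc d, Inc e]] ?R (R(i := 0, d := R d + R i, e := R e + R i))"
    using Suc.hyps(1)[of ?R] Suc.hyps(2) assms by simp
  moreover have "run [Inc d, Inc e] (R(i := n)) ?R"
    using run_append[OF run_single[of d] run_single[of e], where R="R(i := n)"] assms by simp
  ultimately show ?case using Suc.hyps(2) by (metis run_loop)
qed

text \<open>A loop can read a register only by emptying it. The value is moved to the scratch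
  register \<open>t\<close> and then restored to \<open>i\<close> while it is added to
  \<open>d\<close>.\<close>

definition copy_prog :: "nat \<Rightarrow> nat \<Rightarrow> nat \<Rightarrow> instr list" where
  "copy_prog i t d = [While i [Inc t]] @ [While t [Inc i, Inc d]]"

lemma run_copy:
  assumes "i \<noteq> d" "i \<noteq> t" "t \<noteq> d" "R t = 0"
  shows "run (copy_prog i t d) R (R(d := R d + R i))"
proof -
  let ?R = "R(i := 0, t := R t + R i)"
  have "run (copy_prog i t d) R (?R(t := 0, i := ?R i + ?R t, d := ?R d + ?R t))"
    unfolding copy_prog_def using assms by (intro run_append[OF run_move run_move_2]) auto
  also have "?R(t := 0, i := ?R i + ?R t, d := ?R d + ?R t) = R(d := R d + R i)"
    using assms by auto
  finally show ?thesis .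
qed

text \<open>The result is added to the destination register, and all other registers, in particular the
  scratch registers from \<open>k\<close> on, end with their initial values; hence compiled programs compose.\<close>

definition implements :: "instr list \<Rightarrow> recf \<Rightarrow> nat list \<Rightarrow> nat \<Rightarrow> nat \<Rightarrow> bool" where
  "implements p f is d k \<longleftrightarrow>
     (\<forall>R y. rec_eval f (map R is) y \<longrightarrow> (\<forall>j\<ge>k. R j = 0) \<longrightarrow> run p R (R(d := R d + y)))"

definition implementable :: "recf \<Rightarrow> bool" where
  "implementable f \<longleftrightarrow>
     (\<forall>is d k. (\<forall>i\<in>set is. i < k) \<longrightarrow> d < k \<longrightarrow> d \<notin> set is \<longrightarrow> (\<exists>p. implements p f is d k))"

lemma implementableD:
  "implementable f \<Longrightarrow> \<forall>i\<in>set is. i < k \<Longrightarrow> d < k \<Longrightarrow> d \<notin> set is \<Longrightarrow> \<exists>p. implements p f is d k"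
  unfolding implementable_def by blast

lemma implementsD:
  "implements p f is d k \<Longrightarrow> rec_eval f xs y \<Longrightarrow> map R is = xs \<Longrightarrow> \<forall>j\<ge>k. R j = 0 \<Longrightarrow>
    R' = R(d := R d + y) \<Longrightarrow> run p R R'"
  unfolding implements_def by blast

inductive_cases rec_eval_SuccE: "rec_eval Succ xs y"
inductive_cases rec_eval_ProjE: "rec_eval (Proj i) xs y"
inductive_cases rec_eval_CompE: "rec_eval (Comp f gs) xs y"
inductive_cases rec_eval_PrimRecE: "rec_eval (PrimRec f g) xs y"
inductive_cases rec_eval_PrimRec_0E: "rec_eval (PrimRec f g) (0 # xs) y"
inductive_cases rec_eval_PrimRec_SucE: "rec_eval (PrimRec f g) (Suc n # xs) y"
inductive_cases rec_eval_MuE: "rec_eval (Mu f) xs y"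

section \<open>A program for each constructor of recursive functions\<close>

lemma implementable_Zero: "implementable Zero"
proof -
  have "implements [] Zero is d k" for "is" d k
    unfolding implements_def
  proof (intro allI impI)
    fix R :: "nat \<Rightarrow> nat" and y
    assume "rec_eval Zero (map R is) y"
    then have "y = 0" by cases auto
    then show "run [] R (R(d := R d + y))" by (simp add: run_Nil)
  qed
  then show ?thesis unfolding implementable_def by blast
qed

lemma implementable_Proj: "implementable (Proj i)"
  unfolding implementable_def
proof (intro allI impI)
  fix "is" :: "nat list" and d k :: nat
  assume *: "\<forall>i\<in>set is. i < k" "d < k" "d \<notin> set is"
  have "implements (copy_prog (is ! i) k d) (Proj i) is d k"
    unfolding implements_def
  proof (intro allI impI)
    fix R y assume "rec_eval (Proj i) (map R is) y" and z: "\<forall>j\<ge>k. R j = 0"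
    then have i: "i < length is" and y: "y = R (is ! i)"
      by (auto elim: rec_eval_ProjE)
    have "is ! i < k" "is ! i \<noteq> d" using i * nth_mem by blast+
    then show "run (copy_prog (is ! i) k d) R (R(d := R d + y))"
      unfolding y using run_copy[of "is ! i" d k R] * z by auto
  qed
  then show "\<exists>p. implements p (Proj i) is d k" ..
qed

lemma implementable_Succ: "implementable Succ"
  unfolding implementable_def
proof (intro allI impI)
  fix "is" :: "nat list" and d k :: nat
  assume *: "\<forall>i\<in>set is. i < k" "d < k" "d \<notin> set is"
  have "implements (copy_prog (is ! 0) k d @ [Inc d]) Succ is d k"
    unfolding implements_def
  proof (intro allI impI)
    fix R y assume "rec_eval Succ (map R is) y" and z: "\<forall>j\<ge>k. R j = 0"
    then obtain i where i: "is = [i]" and y: "y = Suc (R i)"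
      by (auto elim!: rec_eval_SuccE)
    have "run (copy_prog i k d) R (R(d := R d + R i))"
      using run_copy[of i d k R] * z i by auto
    from run_append[OF this run_single[of d]]
    show "run (copy_prog (is ! 0) k d @ [Inc d]) R (R(d := R d + y))"
      by (simp add: i y)
  qed
  then show "\<exists>p. implements p Succ is d k" ..
qed

text \<open>The values go to consecutive registers. In the induction \<open>d\<close> moves up while
  the scratch bound \<open>k\<close> stays fixed: the values already stored lie below
  \<open>k\<close>, so they may be nonzero when the next program starts.\<close>

lemma implementable_args:
  assumes "\<forall>g\<in>set gs. implementable g" "\<forall>i\<in>set is. i < d" "d + length gs \<le> k"
  shows "\<exists>p. \<forall>R ys. list_all2 (\<lambda>g. rec_eval g (map R is)) gs ys \<longrightarrow> (\<forall>j\<ge>k. R j = 0) \<longrightarrow>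
    run p R (\<lambda>j. if d \<le> j \<and> j < d + length gs then R j + ys ! (j - d) else R j)"
  using assms
proof (induction gs arbitrary: d)
  case Nil
  then show ?case by (auto intro!: exI[of _ "[]"] simp: run_Nil not_less[symmetric] cong: if_cong)
next
  case (Cons g gs)
  have "\<forall>i\<in>set is. i < k" "d \<notin> set is" using Cons.prems by auto
  then obtain p where p: "implements p g is d k"
    using Cons.prems implementableD[of g "is" k d] by auto
  obtain q where q: "list_all2 (\<lambda>g. rec_eval g (map R is)) gs ys \<Longrightarrow> \<forall>j\<ge>k. R j = 0 \<Longrightarrow>
     run q R (\<lambda>j. if Suc d \<le> j \<and> j < Suc d + length gs then R j + ys ! (j - Suc d) else R j)"
    for R ys using Cons.IH[of "Suc d"] Cons.prems by fastforce
  show ?case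
  proof (rule exI[of _ "p @ q"], intro allI impI)
    fix R zs
    assume "list_all2 (\<lambda>g. rec_eval g (map R is)) (g # gs) zs" and z: "\<forall>j\<ge>k. R j = 0"
    then obtain y ys where zs: "zs = y # ys" and y: "rec_eval g (map R is) y"
      and ys: "list_all2 (\<lambda>g. rec_eval g (map R is)) gs ys"
      by (auto simp: list_all2_Cons1)
    let ?R = "R(d := R d + y)"
    have 1: "run p R ?R" using implementsD[OF p y refl z] by simp
    have m: "map ?R is = map R is" using Cons.prems(2) by auto
    have "\<forall>j\<ge>k. ?R j = 0" using z Cons.prems(3) by auto
    from q[of ?R, unfolded m, OF ys this]
    have 2: "run q ?R (\<lambda>j. if Suc d \<le> j \<and> j < Suc d + length gs then ?R j + ys ! (j - Suc d) else ?R j)" .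
    have "(\<lambda>j. if Suc d \<le> j \<and> j < Suc d + length gs then ?R j + ys ! (j - Suc d) else ?R j) =
      (\<lambda>j. if d \<le> j \<and> j < d + length (g # gs) then R j + zs ! (j - d) else R j)"
    proof
      fix j
      consider "j < d" | "j = d" | e where "j = Suc d + e"
        by (metis less_iff_Suc_add linorder_neqE_nat add_Suc)
      then show "(if Suc d \<le> j \<and> j < Suc d + length gs then ?R j + ys ! (j - Suc d) else ?R j) =
        (if d \<le> j \<and> j < d + length (g # gs) then R j + zs ! (j - d) else R j)"
        by cases (auto simp: zs)
    qed
    with run_append[OF 1 2]
    show "run (p @ q) R (\<lambda>j. if d \<le> j \<and> j < d + length (g # gs) then R j + zs ! (j - d) else R j)"
      by simp
  qed
qed

lemma implementable_Comp:
  assumes f: "implementable f" and gs: "\<forall>g\<in>set gs. implementable g"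
  shows "implementable (Comp f gs)"
  unfolding implementable_def
proof (intro allI impI)
  fix "is" :: "nat list" and d k :: nat
  assume *: "\<forall>i\<in>set is. i < k" "d < k" "d \<notin> set is"
  let ?m = "length gs"
  obtain p where p: "list_all2 (\<lambda>g. rec_eval g (map R is)) gs ys \<Longrightarrow> \<forall>j\<ge>k + ?m. R j = 0 \<Longrightarrow>
      run p R (\<lambda>j. if k \<le> j \<and> j < k + ?m then R j + ys ! (j - k) else R j)" for R ys
    using implementable_args[OF gs *(1) order_refl] by blast
  obtain q where q: "implements q f [k..<k + ?m] d (k + ?m)"
    using * implementableD[OF f, of "[k..<k + ?m]" "k + ?m" d] by fastforce
  \<comment> \<open>The registers holding the arguments of \<open>f\<close> are scratch space of the
    composed program, so the trailing loops clear them.\<close>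
  have "implements (p @ q @ map (\<lambda>i. While i []) [k..<k + ?m]) (Comp f gs) is d k"
    unfolding implements_def
  proof (intro allI impI)
    fix R z assume "rec_eval (Comp f gs) (map R is) z" and 0: "\<forall>j\<ge>k. R j = 0"
    then obtain ys where ys: "list_all2 (\<lambda>g. rec_eval g (map R is)) gs ys" and z: "rec_eval f ys z"
      by (auto elim: rec_eval_CompE)
    define R1 where "R1 = (\<lambda>j. if k \<le> j \<and> j < k + ?m then R j + ys ! (j - k) else R j)"
    have l: "length ys = ?m" using ys by (simp add: list_all2_lengthD)
    have 1: "run p R R1" unfolding R1_def using p[OF ys] 0 by simp
    have "map R1 [k..<k + ?m] = ys"
      using 0 l by (auto simp: R1_def intro!: nth_equalityI)
    moreover have "\<forall>j\<ge>k + ?m. R1 j = 0" using 0 by (auto simp: R1_def)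
    ultimately have 2: "run q R1 (R1(d := R1 d + z))" by (rule implementsD[OF q z]) simp
    have "(\<lambda>j. if j \<in> set [k..<k + ?m] then 0 else (R1(d := R1 d + z)) j) = R(d := R d + z)"
      using * 0 by (auto simp: R1_def fun_eq_iff)
    with run_append[OF 1 run_append[OF 2 run_clear_all, of "[k..<k + ?m]"]]
    show "run (p @ q @ map (\<lambda>i. While i []) [k..<k + ?m]) R (R(d := R d + z))" by simp
  qed
  then show "\<exists>p. implements p (Comp f gs) is d k" ..
qed

lemma implementable_PrimRec:
  assumes f: "implementable f" and g: "implementable g"
  shows "implementable (PrimRec f g)"
  unfolding implementable_def
proof (intro allI impI)
  fix js :: "nat list" and d k :: nat
  assume *: "\<forall>i\<in>set js. i < k" "d < k" "d \<notin> set js"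
  show "\<exists>p. implements p (PrimRec f g) js d k"
  proof (cases js)
    case Nil
    then have "implements [] (PrimRec f g) js d k"
      unfolding implements_def by (auto elim: rec_eval_PrimRecE)
    then show ?thesis ..
  next
    case (Cons i "is")
    \<comment> \<open>\<open>?t\<close> counts the remaining rounds down, \<open>?c\<close> counts
      the finished rounds up, \<open>?a\<close> holds the value reached so far, and
      \<open>?b\<close> receives the next value before it replaces the old one in
      \<open>?a\<close>.\<close>
    let ?t = k and ?c = "k + 1" and ?a = "k + 2" and ?b = "k + 3"
    have less: "i < k" "\<forall>j\<in>set is. j < k" using * Cons by auto
    obtain p where p: "implements p f is ?a (k + 4)"
      using less implementableD[OF f, of "is" "k + 4" ?a] by fastforce
    obtain q where q: "implements q g (?c # ?a # is) ?b (k + 4)"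
      using less implementableD[OF g, of "?c # ?a # is" "k + 4" ?b] by fastforce
    define body where "body = q @ [While ?a []] @ [While ?b [Inc ?a]] @ [Inc ?c]"
    define prog where
      "prog = copy_prog i ?b ?t @ p @ [While ?t body] @ [While ?a [Inc d]] @ [While ?c []]"
    have "implements prog (PrimRec f g) js d k"
      unfolding implements_def
    proof (intro allI impI)
      fix R y assume ev: "rec_eval (PrimRec f g) (map R js) y" and 0: "\<forall>j\<ge>k. R j = 0"
      define S where "S t c a = R(?t := t, ?c := c, ?a := a)" for t c a
      have S_is: "map (S t c a) is = map R is" for t c a
        using less by (auto simp: S_def)
      have S_0: "\<forall>j\<ge>k + 4. S t c a j = 0" for t c a using 0 by (auto simp: S_def)
      have step: "run body (S t c a) (S t (Suc c) a')" if "rec_eval g (c # a # map R is) a'" for t c a a'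
      proof -
        have 1: "run q (S t c a) ((S t c a)(?b := a'))"
          using 0 S_is by (intro implementsD[OF q that _ S_0]) (auto simp: S_def)
        let ?R1 = "(S t c a)(?b := a', ?a := 0)"
        let ?R2 = "?R1(?b := 0, ?a := ?R1 ?a + ?R1 ?b)"
        have 2: "run [While ?a []] ((S t c a)(?b := a')) ?R1" by (rule run_clear)
        have 3: "run [While ?b [Inc ?a]] ?R1 ?R2" by (rule run_move) simp
        have "run body (S t c a) (?R2(?c := Suc (?R2 ?c)))"
          unfolding body_def
          by (rule run_append[OF 1 run_append[OF 2 run_append[OF 3 run_single]]])
        also have "?R2(?c := Suc (?R2 ?c)) = S t (Suc c) a'" using 0 by (auto simp: S_def)
        finally show ?thesis .
      qed
      \<comment> \<open>Evaluation peels off the last round first, while the loop executes it last.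
        The claim therefore has a continuation: any run from the state after \<open>n\<close>
        rounds, with \<open>m\<close> more to come, extends backwards to a run from the state before
        the first round.\<close>
      have loop: "\<exists>a. rec_eval f (map R is) a \<and>
          (\<forall>R'. run [While ?t body] (S m n y) R' \<longrightarrow> run [While ?t body] (S (n + m) 0 a) R')"
        if "rec_eval (PrimRec f g) (n # map R is) y" for n m y
        using that
      proof (induction n arbitrary: m y)
        case 0
        then show ?case by (auto elim: rec_eval_PrimRec_0E)
      next
        case (Suc n)
        from Suc.prems obtain z where z: "rec_eval (PrimRec f g) (n # map R is) z"
          and y: "rec_eval g (n # z # map R is) y" by (auto elim: rec_eval_PrimRec_SucE)
        from Suc.IH[OF z, of "Suc m"] obtain a where a: "rec_eval f (map R is) a"
          and IH: "\<And>R'. run [While ?t body] (S (Suc m) n z) R' \<Longrightarrow>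
            run [While ?t body] (S (n + Suc m) 0 a) R'" by blast
        have "run [While ?t body] (S (Suc n + m) 0 a) R'"
          if "run [While ?t body] (S m (Suc n) y) R'" for R'
        proof -
          have "(S (Suc m) n z)(?t := m) = S m n z" by (auto simp: S_def)
          then have "run [While ?t body] (S (Suc m) n z) R'"
            using step[OF y, of m] that run_loop[of "S (Suc m) n z" ?t m body "S m (Suc n) y" R']
            by (simp add: S_def[of "Suc m"])
          from IH[OF this] show ?thesis by simp
        qed
        with a show ?case by blast
      qed
      have "rec_eval (PrimRec f g) (R i # map R is) y" using ev Cons by simp
      from loop[OF this, of 0] obtain a where a: "rec_eval f (map R is) a"
        and l: "\<And>R'. run [While ?t body] (S 0 (R i) y) R' \<Longrightarrow>
            run [While ?t body] (S (R i) 0 a) R'" by auto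
      have "run (copy_prog i ?b ?t) R (R(?t := R ?t + R i))"
        using less 0 by (intro run_copy) auto
      also have "R(?t := R ?t + R i) = S (R i) 0 0" using 0 by (auto simp: S_def)
      finally have 1: "run (copy_prog i ?b ?t) R (S (R i) 0 0)" .
      have 2: "run p (S (R i) 0 0) (S (R i) 0 a)"
        using S_is by (intro implementsD[OF p a _ S_0]) (auto simp: S_def)
      have 3: "run [While ?t body] (S (R i) 0 a) (S 0 (R i) y)"
        by (rule l, rule run_loop_exit) (simp add: S_def)
      let ?S = "S 0 (R i) y"
      let ?R1 = "?S(?a := 0, d := ?S d + ?S ?a)"
      have 4: "run [While ?a [Inc d]] ?S ?R1" using * by (intro run_move) auto
      have "run prog R (?R1(?c := 0))"
        unfolding prog_def
        by (rule run_append[OF 1 run_append[OF 2 run_append[OF 3 run_append[OF 4 run_clear]]]])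
      also have "?R1(?c := 0) = R(d := R d + y)"
        using * 0 by (auto simp: S_def fun_eq_iff)
      finally show "run prog R (R(d := R d + y))" .
    qed
    then show ?thesis ..
  qed
qed

lemma implementable_Mu:
  assumes f: "implementable f"
  shows "implementable (Mu f)"
  unfolding implementable_def
proof (intro allI impI)
  fix "is" :: "nat list" and d k :: nat
  assume *: "\<forall>i\<in>set is. i < k" "d < k" "d \<notin> set is"
  let ?c = k and ?v = "k + 1"
  obtain p where p: "implements p f (?c # is) ?v (k + 2)"
    using * implementableD[OF f, of "?c # is" "k + 2" ?v] by fastforce
  \<comment> \<open>The loop test only decrements \<open>?v\<close>; the remainder is cleared before
    \<open>p\<close> adds the next value of \<open>f\<close>. When the loop ends, \<open>?c\<close>
    holds the result of the minimisation.\<close>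
  define body where "body = [While ?v []] @ [Inc ?c] @ p"
  have "implements (p @ [While ?v body] @ [While ?c [Inc d]]) (Mu f) is d k"
    unfolding implements_def
  proof (intro allI impI)
    fix R n assume "rec_eval (Mu f) (map R is) n" and 0: "\<forall>j\<ge>k. R j = 0"
    then have below: "\<forall>m<n. \<exists>v. rec_eval f (m # map R is) (Suc v)"
      and zero: "rec_eval f (n # map R is) 0"
      by (auto elim: rec_eval_MuE)
    define S where "S c v = R(?c := c, ?v := v)" for c v
    have eval: "run p (S c 0) (S c v)" if "rec_eval f (c # map R is) v" for c v
      using 0 * by (intro implementsD[OF p that]) (auto simp: S_def)
    have loop: "run [While ?v body] (S m v) (S n 0)"
      if "rec_eval f (m # map R is) v" "m \<le> n" for m v
      using that(2,1)
    proof (induction m arbitrary: v rule: inc_induct)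
      case base
      then have "v = 0" using zero rec_eval_deterministic by blast
      moreover have "S n 0 ?v = 0" by (simp add: S_def)
      ultimately show ?case using run_loop_exit[of "S n 0" ?v] by simp
    next
      case (step m)
      from step.hyps below obtain u where "rec_eval f (m # map R is) (Suc u)" by blast
      then have v: "v = Suc u" using step.prems rec_eval_deterministic by blast
      obtain w where w: "rec_eval f (Suc m # map R is) w"
        using below zero step.hyps by (metis Suc_leI le_neq_implies_less)
      have "run [While ?v []] ((S m v)(?v := u)) ((S m v)(?v := u, ?v := 0))" by (rule run_clear)
      also have "(S m v)(?v := u, ?v := 0) = S m 0" by (auto simp: S_def)
      finally have 1: "run [While ?v []] ((S m v)(?v := u)) (S m 0)" .
      have "(S m 0)(?c := Suc (S m 0 ?c)) = S (Suc m) 0" by (auto simp: S_def)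
      with run_single[of ?c "S m 0"] have 2: "run [Inc ?c] (S m 0) (S (Suc m) 0)" by simp
      have "run body ((S m v)(?v := u)) (S (Suc m) w)"
        unfolding body_def by (rule run_append[OF 1 run_append[OF 2 eval[OF w]]])
      moreover have "S m v ?v = Suc u" by (simp add: S_def v)
      ultimately show ?case using run_loop step.IH[OF w] by blast
    qed
    obtain v where v: "rec_eval f (0 # map R is) v" using below zero by (cases n) auto
    have "S 0 0 = R" using 0 by (auto simp: S_def)
    with eval[OF v] have 1: "run p R (S 0 v)" by simp
    let ?R = "(S n 0)(?c := 0, d := S n 0 d + S n 0 ?c)"
    have "run [While ?c [Inc d]] (S n 0) ?R" using * by (intro run_move) auto
    then have "run (p @ [While ?v body] @ [While ?c [Inc d]]) R ?R"
      by (intro run_append[OF 1] run_append[OF loop[OF v]]) simp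
    also have "?R = R(d := R d + n)" using * 0 by (auto simp: S_def)
    finally show "run (p @ [While ?v body] @ [While ?c [Inc d]]) R (R(d := R d + n))" .
  qed
  then show "\<exists>p. implements p (Mu f) is d k" ..
qed

lemma implementable: "implementable f"
  by (induction f)
    (auto intro: implementable_Zero implementable_Succ implementable_Proj implementable_Comp
      implementable_PrimRec implementable_Mu)

corollary compile_unary:
  obtains p where
    "\<And>n y. rec_eval f [n] y \<Longrightarrow> run p (\<lambda>i. if i = 0 then n else 0) ((\<lambda>_. 0)(0 := n, 1 := y))"
proof -
  obtain p where p: "implements p f [0] 1 2"
    using implementableD[OF implementable, of "[0]" 2 1 f] by auto
  show thesis
    by (rule that[of p]) (rule implementsD[OF p], auto simp: fun_eq_iff)
qed

section \<open>Counter programs as deterministic string rewriting\<close>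

datatype tape = Lft | Rgt | Reg nat

datatype head = Ctl "instr list" | Back "instr list" | Fin | Ok

datatype letter = T tape | H head

instance instr :: countable by countable_datatype
instance tape :: countable by countable_datatype
instance head :: countable by countable_datatype
instance letter :: countable by countable_datatype

text \<open>The tape to the left of the head is stored in reverse. The value of a register is the number
  of its occurrences on the tape, in whatever order; the control state is the program still to be
  executed.\<close>

type_synonym config = "tape list \<times> head \<times> tape list"

text \<open>An increment inserts a letter at the head. A loop searches to the right for
  \<open>Reg i\<close>: it deletes this letter and returns to the left marker with the unfolded
  loop, or meets \<open>Rgt\<close> and returns with the continuation. The finished program sweeps
  the tape and gets stuck at \<open>Reg 1\<close>; only if register 1 is empty does it erase both
  markers and leave the single letter \<open>Ok\<close>.\<close>

inductive rule :: "config \<Rightarrow> config \<Rightarrow> bool" where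
  "rule ([], Ctl (Inc i # c), []) ([], Ctl c, [Reg i])"
| "i \<noteq> j \<Longrightarrow> rule ([], Ctl (While i b # c), [Reg j]) ([Reg j], Ctl (While i b # c), [])"
| "rule ([], Ctl (While i b # c), [Reg i]) ([], Back (b @ While i b # c), [])"
| "rule ([], Ctl (While i b # c), [Rgt]) ([], Back c, [Rgt])"
| "rule ([Reg j], Back c, []) ([], Back c, [Reg j])"
| "rule ([Lft], Back c, []) ([Lft], Ctl c, [])"
| "j \<noteq> 1 \<Longrightarrow> rule ([], Ctl [], [Reg j]) ([], Ctl [], [])"
| "rule ([], Ctl [], [Rgt]) ([], Fin, [])"
| "rule ([Lft], Fin, []) ([], Ok, [])"

inductive step :: "config \<Rightarrow> config \<Rightarrow> bool" where
  stepI: "rule (a, h, b) (a', h', b') \<Longrightarrow> step (a @ l, h, b @ r) (a' @ l, h', b' @ r)"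

text \<open>The head state fixes on which side, if any, a letter is read, and the state together
  with this letter determines the rule.\<close>

lemma step_deterministic: "step x y \<Longrightarrow> step x z \<Longrightarrow> y = z"
  by (auto elim!: step.cases rule.cases)

lemma steps_normal_form_unique:
  assumes "step\<^sup>*\<^sup>* x y" "step\<^sup>*\<^sup>* x z" "\<nexists>y'. step y y'" "\<nexists>z'. step z z'"
  shows "y = z"
  using assms
proof (induction rule: converse_rtranclp_induct)
  case base
  then show ?case by (metis converse_rtranclpE)
next
  case (step x x')
  then show ?case by (metis converse_rtranclpE step_deterministic)
qed

abbreviation accepted :: config where "accepted \<equiv> ([], Ok, [])"

lemma accepted_normal: "\<not> step accepted z"
  by (auto elim!: step.cases rule.cases)

lemma rejected_normal: "\<not> step (l, Ctl [], Reg 1 # r) z"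
  by (auto elim!: step.cases rule.cases)

lemma rule_step:
  assumes "rule (a, h, b) (a', h', b')" "x = (a @ l, h, b @ r)" "y = (a' @ l, h', b' @ r)"
  shows "step x y"
  using assms stepI by simp

section \<open>Simulation of counter programs by rewriting\<close>

lemma steps_back: "step\<^sup>*\<^sup>* (map Reg V @ [Lft], Back c, r) ([Lft], Ctl c, map Reg (rev V) @ r)"
proof (induction V arbitrary: r)
  case Nil
  have "step ([Lft], Back c, r) ([Lft], Ctl c, r)"
    by (rule rule_step[OF rule.intros(6)]) auto
  then show ?case by simp
next
  case (Cons j V)
  have "step (map Reg (j # V) @ [Lft], Back c, r) (map Reg V @ [Lft], Back c, Reg j # r)"
    by (rule rule_step[OF rule.intros(5)]) auto
  with Cons[of "Reg j # r"] show ?case by (simp add: converse_rtranclp_into_rtranclp)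
qed

lemma steps_search:
  "i \<notin> set V \<Longrightarrow> step\<^sup>*\<^sup>* (l, Ctl (While i b # c), map Reg V @ r)
     (map Reg (rev V) @ l, Ctl (While i b # c), r)"
proof (induction V arbitrary: l)
  case Nil
  then show ?case by simp
next
  case (Cons j V)
  have "step (l, Ctl (While i b # c), map Reg (j # V) @ r) (Reg j # l, Ctl (While i b # c), map Reg V @ r)"
    by (rule rule_step[OF rule.intros(2)]) (use Cons.prems in auto)
  with Cons.IH[of "Reg j # l"] Cons.prems show ?case
    by (simp add: converse_rtranclp_into_rtranclp)
qed

abbreviation home :: "instr list \<Rightarrow> nat list \<Rightarrow> config" where
  "home c W \<equiv> ([Lft], Ctl c, map Reg W @ [Rgt])"

text \<open>Rewriting does not keep the registers sorted: an increment inserts its letter next to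
  \<open>Lft\<close>, and a loop deletes the first matching letter. Hence only letter counts are
  compared with register contents, and the induction ranges over all arrangements
  \<open>W\<close>.\<close>

lemma steps_run:
  "run p R R' \<Longrightarrow> count_list W = R \<Longrightarrow> \<exists>W'. count_list W' = R' \<and> step\<^sup>*\<^sup>* (home p W) (home [] W')"
proof (induction arbitrary: W rule: run.induct)
  case (run_Nil R)
  then show ?case by blast
next
  case (run_Inc c R i R')
  have "count_list (i # W) = R(i := Suc (R i))" using run_Inc.prems by auto
  then obtain W' where "count_list W' = R'" "step\<^sup>*\<^sup>* (home c (i # W)) (home [] W')"
    using run_Inc.IH by blast
  moreover have "step (home (Inc i # c) W) (home c (i # W))"
    by (rule rule_step[OF rule.intros(1)]) auto
  ultimately show ?case
    by (intro exI[of _ W']) (simp add: converse_rtranclp_into_rtranclp)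
next
  case (run_While_0 R i c R' b)
  have "i \<notin> set W" using run_While_0 by (auto simp: count_list_0_iff[symmetric])
  then have "step\<^sup>*\<^sup>* (home (While i b # c) W) (map Reg (rev W) @ [Lft], Ctl (While i b # c), [Rgt])"
    by (rule steps_search)
  moreover have "step (map Reg (rev W) @ [Lft], Ctl (While i b # c), [Rgt])
      (map Reg (rev W) @ [Lft], Back c, [Rgt])"
    by (rule rule_step[OF rule.intros(4)]) auto
  moreover have "step\<^sup>*\<^sup>* (map Reg (rev W) @ [Lft], Back c, [Rgt]) (home c W)"
    using steps_back[of "rev W" c "[Rgt]"] by simp
  ultimately have "step\<^sup>*\<^sup>* (home (While i b # c) W) (home c W)" by simp
  with run_While_0.IH[OF run_While_0.prems] show ?case using rtranclp_trans[of step] by fast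
next
  case (run_While_Suc R i n b c R')
  have "count_list W i \<noteq> 0" using run_While_Suc by auto
  then have "i \<in> set W" by (simp add: count_list_0_iff)
  then obtain V U where W: "W = V @ i # U" and V: "i \<notin> set V" by (meson split_list_first)
  let ?r = "map Reg U @ [Rgt]" and ?c = "b @ While i b # c"
  have "step\<^sup>*\<^sup>* (home (While i b # c) W) (map Reg (rev V) @ [Lft], Ctl (While i b # c), Reg i # ?r)"
    using steps_search[OF V, of "[Lft]" b c "Reg i # ?r"] by (simp add: W)
  moreover have "step (map Reg (rev V) @ [Lft], Ctl (While i b # c), Reg i # ?r)
      (map Reg (rev V) @ [Lft], Back ?c, ?r)"
    by (rule rule_step[OF rule.intros(3)]) auto
  moreover have "step\<^sup>*\<^sup>* (map Reg (rev V) @ [Lft], Back ?c, ?r) (home ?c (V @ U))"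
    using steps_back[of "rev V" ?c ?r] by simp
  ultimately have "step\<^sup>*\<^sup>* (home (While i b # c) W) (home ?c (V @ U))" by simp
  moreover have "count_list (V @ U) = R(i := n)"
  proof
    fix j
    have "R i = count_list V i + Suc (count_list U i)" "R i = Suc n"
      using run_While_Suc W by auto
    then show "count_list (V @ U) j = (R(i := n)) j"
      using run_While_Suc.prems W by auto
  qed
  ultimately show ?case using run_While_Suc.IH rtranclp_trans[of step] by fast
qed

lemma steps_sweep:
  "1 \<notin> set V \<Longrightarrow> step\<^sup>*\<^sup>* (l, Ctl [], map Reg V @ r) (l, Ctl [], r)"
proof (induction V)
  case (Cons j V)
  have "step (l, Ctl [], map Reg (j # V) @ r) (l, Ctl [], map Reg V @ r)"
    by (rule rule_step[OF rule.intros(7)]) (use Cons.prems in auto)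
  with Cons show ?case by (simp add: converse_rtranclp_into_rtranclp)
qed simp

lemma steps_accept:
  assumes "1 \<notin> set W"
  shows "step\<^sup>*\<^sup>* (home [] W) accepted"
proof -
  have "step ([Lft], Ctl [], [Rgt]) ([Lft], Fin, [])"
    by (rule rule_step[OF rule.intros(8)]) auto
  moreover have "step ([Lft], Fin, []) accepted"
    by (rule rule_step[OF rule.intros(9)]) auto
  ultimately show ?thesis using steps_sweep[OF assms, of "[Lft]" "[Rgt]"]
    by (meson rtranclp.rtrancl_into_rtrancl)
qed

text \<open>The sweep stops before the first \<open>Reg 1\<close> in a normal form other than
  \<open>accepted\<close>; determinism leaves no other outcome.\<close>

lemma steps_reject:
  assumes "1 \<in> set W"
  shows "\<not> step\<^sup>*\<^sup>* (home [] W) accepted"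
proof
  assume acc: "step\<^sup>*\<^sup>* (home [] W) accepted"
  obtain V U where "W = V @ 1 # U" "1 \<notin> set V" using assms by (meson split_list_first)
  then have "step\<^sup>*\<^sup>* (home [] W) ([Lft], Ctl [], Reg 1 # map Reg U @ [Rgt])"
    using steps_sweep[of V "[Lft]" "Reg 1 # map Reg U @ [Rgt]"] by simp
  from steps_normal_form_unique[OF acc this] show False
    using accepted_normal rejected_normal by blast
qed

text \<open>Starting in \<open>Back p\<close> at the right end puts the input to the left of
  everything that depends on the program. The sequent then consists of \<open>Lft\<close>,
  \<open>n\<close> input letters and a tail that does not depend on \<open>n\<close>.\<close>

abbreviation start :: "instr list \<Rightarrow> nat \<Rightarrow> config" where
  "start p n \<equiv> (replicate n (Reg 0) @ [Lft], Back p, [Rgt])"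

lemma start_accepts_iff:
  assumes "run p (\<lambda>i. if i = 0 then n else 0) R"
  shows "step\<^sup>*\<^sup>* (start p n) accepted \<longleftrightarrow> R 1 = 0"
proof -
  have "count_list (replicate n 0) = (\<lambda>i. if i = 0 then n else 0)"
    by (induction n) (auto simp: fun_eq_iff)
  from steps_run[OF assms this] obtain W where W: "count_list W = R"
    and s: "step\<^sup>*\<^sup>* (home p (replicate n 0)) (home [] W)" by blast
  have s: "step\<^sup>*\<^sup>* (start p n) (home [] W)"
    using steps_back[of "replicate n 0" p "[Rgt]"] s by simp
  have R1: "R 1 = 0 \<longleftrightarrow> 1 \<notin> set W" using W by (auto simp: count_list_0_iff)
  show ?thesis
  proof
    assume "R 1 = 0"
    then show "step\<^sup>*\<^sup>* (start p n) accepted" using s steps_accept R1 by (meson rtranclp_trans)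
  next
    assume acc: "step\<^sup>*\<^sup>* (start p n) accepted"
    \<comment> \<open>By determinism the run to \<open>home [] W\<close> is an initial part of the
      accepting run, since \<open>accepted\<close> has no successor.\<close>
    have "step\<^sup>*\<^sup>* (home [] W) accepted"
      using s acc
    proof (induction rule: converse_rtranclp_induct)
      case (step y z)
      then show ?case using step_deterministic accepted_normal by (metis converse_rtranclpE)
    qed
    then show "R 1 = 0" using steps_reject R1 by blast
  qed
qed

subsection \<open>Finitely many rules suffice\<close>

text \<open>These are the control states met while \<open>p\<close> is executed with
  \<open>c\<close> to follow. Unfolding a loop lengthens the program, yet finitely many states
  arise, because execution of the body leads back to the loop itself.\<close>

fun controls :: "instr list \<Rightarrow> instr list \<Rightarrow> instr list set" where
  "controls [] c = {c}"
| "controls (Inc i # p) c = insert (Inc i # p @ c) (controls p c)"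
| "controls (While i b # p) c =
     insert (While i b # p @ c) (controls b (While i b # p @ c) \<union> controls p c)"

lemma finite_controls: "finite (controls p c)"
  by (induction p c rule: controls.induct) auto

lemma controls_start: "p @ c \<in> controls p c"
  by (cases "(p, c)" rule: controls.cases) auto

text \<open>Closure under execution can fail only at \<open>c\<close>, about which nothing is known;
  for \<open>c = []\<close> nothing is left to execute there.\<close>

lemma controls_closed:
  "q \<in> controls p c \<Longrightarrow> q = c \<or>
     (\<exists>i q'. q = Inc i # q' \<and> q' \<in> controls p c) \<or>
     (\<exists>i b q'. q = While i b # q' \<and> q' \<in> controls p c \<and> b @ While i b # q' \<in> controls p c)"
proof (induction p c rule: controls.induct)
  case (3 i b p c)
  have "p @ c \<in> controls p c" "b @ While i b # p @ c \<in> controls b (While i b # p @ c)"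
    by (rule controls_start)+
  with 3 show ?case by auto
qed (use controls_start in auto)

text \<open>A letter \<open>Reg i\<close> gets onto the tape only as input, in register 0, or by an
  increment; loops merely search for it. Register 1 is the output.\<close>

definition registers :: "instr list \<Rightarrow> nat set" where
  "registers p = {0, 1} \<union> {i. \<exists>c. Inc i # c \<in> controls p []}"

definition configs :: "instr list \<Rightarrow> config set" where
  "configs p = {(l, h, r). set l \<union> set r \<subseteq> {Lft, Rgt} \<union> Reg ` registers p \<and>
     h \<in> {Fin, Ok} \<union> Ctl ` controls p [] \<union> Back ` controls p []}"

definition local_rules :: "instr list \<Rightarrow> (config \<times> config) set" where
  "local_rules p = {(z, z'). rule z z' \<and> z \<in> configs p}"

lemma rule_configs: "rule z z' \<Longrightarrow> z \<in> configs p \<Longrightarrow> z' \<in> configs p"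
  by (cases rule: rule.cases)
    (auto simp: configs_def registers_def dest: controls_closed)

text \<open>A rule touches at most one letter on either side of the head, and a fixed program has
  finitely many tape letters and control states.\<close>

lemma finite_local_rules: "finite (local_rules p)"
proof -
  \<comment> \<open>The value 0 for loops is a dummy that makes the set an image of
    \<open>controls p []\<close>.\<close>
  have "registers p \<subseteq> {0, 1} \<union> (\<lambda>c. case hd c of Inc i \<Rightarrow> i | While i b \<Rightarrow> 0) ` controls p []"
    unfolding registers_def by (force simp: image_iff)
  then have "finite (registers p)" by (rule finite_subset) (simp add: finite_controls)
  then have t: "finite {l. set l \<subseteq> {Lft, Rgt} \<union> Reg ` registers p \<and> length l \<le> 1}" (is "finite ?L")
    by (intro finite_lists_length_le) auto
  let ?Z = "?L \<times> ({Fin, Ok} \<union> Ctl ` controls p [] \<union> Back ` controls p []) \<times> ?L"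
  have "finite (?Z \<times> ?Z)" using t finite_controls by (intro finite_cartesian_product) auto
  moreover have "local_rules p \<subseteq> ?Z \<times> ?Z"
  proof (rule subrelI)
    fix z z'
    assume "(z, z') \<in> local_rules p"
    then have r: "rule z z'" and "z \<in> configs p" by (auto simp: local_rules_def)
    moreover from this have "z' \<in> configs p" by (rule rule_configs)
    moreover from r have "length (fst z) \<le> 1 \<and> length (snd (snd z)) \<le> 1 \<and>
        length (fst z') \<le> 1 \<and> length (snd (snd z')) \<le> 1"
      by cases auto
    ultimately show "(z, z') \<in> ?Z \<times> ?Z" by (auto simp: configs_def)
  qed
  ultimately show ?thesis by (rule finite_subset[rotated])
qed

lemma step_local:
  assumes "step z z'" "z \<in> configs p"
  obtains a h b a' h' b' l r where "((a, h, b), (a', h', b')) \<in> local_rules p"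
    "z = (a @ l, h, b @ r)" "z' = (a' @ l, h', b' @ r)" "z' \<in> configs p"
  using assms
proof cases
  case (stepI a h b a' h' b' l r)
  then have "(a, h, b) \<in> configs p" using assms(2) by (auto simp: configs_def)
  moreover from rule_configs[OF stepI(3) this] have "z' \<in> configs p"
    using stepI assms(2) by (auto simp: configs_def)
  ultimately show thesis using stepI that by (auto simp: local_rules_def)
qed

lemma start_configs: "start p n \<in> configs p"
  using controls_start[of p "[]"] by (auto simp: configs_def registers_def)

section \<open>Encoding the rewriting system in sequents\<close>

fun word :: "config \<Rightarrow> letter list" where
  "word (l, h, r) = map T (rev l) @ H h # map T r"

abbreviation atom :: "letter \<Rightarrow> 's fm" where
  "atom a \<equiv> Var (to_nat a)"

text \<open>Formulae have no unit, so there is no product for the empty word; the word of a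
  configuration always contains a head.\<close>

fun word_fm :: "letter list \<Rightarrow> 's fm" where
  "word_fm [] = undefined"
| "word_fm [a] = atom a"
| "word_fm (a # b # w) = Prod (atom a) (word_fm (b # w))"

fun rule_fm :: "config \<times> config \<Rightarrow> 's fm" where
  "rule_fm (z, z') = LDiv (word_fm (word z)) (word_fm (word z'))"

text \<open>Without weakening, the banged rules have to be used up at the end of a computation; this is
  what the division by them in the following formula is for.\<close>

definition cleanup_fm :: "'s \<Rightarrow> 's fm list \<Rightarrow> 's fm" where
  "cleanup_fm s As = LDiv (atom (H Ok)) (foldr (\<lambda>A B. RDiv B (Bang s A)) As (atom (H Ok)))"

lemma word_neq_Nil: "word z \<noteq> []"
  by (cases z) auto

lemma word_fm_formulae: "w \<noteq> [] \<Longrightarrow> word_fm w \<in> formulae \<Sigma>"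
  by (induction w rule: word_fm.induct) (auto simp: formulae_def)

lemma rule_fm_formulae: "rule_fm zz \<in> formulae \<Sigma>"
  using word_fm_formulae[OF word_neq_Nil, of _ \<Sigma>]
  by (cases zz) (auto simp: formulae_def simp del: word.simps)

lemma cleanup_fm_formulae:
  assumes "s \<in> labels \<Sigma>" "set As \<subseteq> formulae \<Sigma>"
  shows "cleanup_fm s As \<in> formulae \<Sigma>"
proof -
  have "foldr (\<lambda>A B. RDiv B (Bang s A)) As (atom (H Ok)) \<in> formulae \<Sigma>"
    using assms by (induction As) (auto simp: formulae_def)
  then show ?thesis by (simp add: cleanup_fm_def formulae_def)
qed

section \<open>From accepting computations to derivations\<close>

lemma derivable_word_fm: "w \<noteq> [] \<Longrightarrow> derivable \<Sigma> (map atom w) (word_fm w)"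
proof (induction w rule: word_fm.induct)
  case (2 a)
  then show ?case by (simp add: Ax formulae_def)
next
  case (3 a b w)
  have "derivable \<Sigma> [atom a] (atom a)" by (simp add: Ax formulae_def)
  from ProdR[OF this] 3 show ?case by simp
qed simp

lemma derivable_word_fm_left:
  "w \<noteq> [] \<Longrightarrow> derivable \<Sigma> (\<Gamma> @ map atom w @ \<Delta>) C \<Longrightarrow> derivable \<Sigma> (\<Gamma> @ [word_fm w] @ \<Delta>) C"
proof (induction w arbitrary: \<Gamma> rule: word_fm.induct)
  case (3 a b w)
  have "derivable \<Sigma> ((\<Gamma> @ [atom a]) @ [word_fm (b # w)] @ \<Delta>) C"
    by (rule "3.IH") (use "3.prems" in auto)
  then have "derivable \<Sigma> (\<Gamma> @ [atom a, word_fm (b # w)] @ \<Delta>) C" by simp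
  from ProdL[OF this] show ?case by simp
qed simp_all

text \<open>The outermost divisor of the folded formula belongs to the first element of
  \<open>As\<close>, so the banged formulae are absorbed from left to right, each by an axiom and
  without structural rules.\<close>

lemma derivable_cleanup:
  assumes "s \<in> labels \<Sigma>" "set As \<subseteq> formulae \<Sigma>"
  shows "derivable \<Sigma> ([atom (H Ok)] @ cleanup_fm s As # map (Bang s) As) (atom (H Ok))"
proof -
  let ?e = "atom (H Ok)" and ?F = "\<lambda>A B. RDiv B (Bang s A)"
  have e: "derivable \<Sigma> [?e] ?e" by (simp add: Ax formulae_def)
  have "derivable \<Sigma> (foldr ?F As ?e # map (Bang s) As) ?e"
    using assms(2)
  proof (induction As)
    case (Cons A As)
    have "derivable \<Sigma> [Bang s A] (Bang s A)"
      using Cons.prems assms(1) by (auto intro!: Ax simp: formulae_def)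
    from RDivL[OF this, of "[]" "foldr ?F As ?e" "map (Bang s) As"] Cons show ?case by simp
  qed (use e in simp)
  from LDivL[OF e, of "[]", simplified, OF this] show ?thesis by (simp add: cleanup_fm_def)
qed

text \<open>Read from the conclusion upwards: \<open>Contr2\<close> copies the banged rule from the
  end to the place just after \<open>word z\<close>, \<open>BangL\<close> opens the copy,
  \<open>LDivL\<close> uses it to trade \<open>word z\<close> for the product of
  \<open>word z'\<close>, and \<open>ProdL\<close> splits this product.\<close>

lemma derivable_rewrite:
  assumes s: "s \<in> labels \<Sigma>" "s \<in> contr \<Sigma>" and A: "rule_fm (z, z') \<in> set As"
    and d: "derivable \<Sigma> (map atom x @ map atom (word z') @ map atom y @ \<Theta> @ map (Bang s) As) C"
  shows "derivable \<Sigma> (map atom x @ map atom (word z) @ map atom y @ \<Theta> @ map (Bang s) As) C"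
proof -
  let ?x = "map atom x" and ?u = "map atom (word z)" and ?y = "map atom y"
  let ?A = "rule_fm (z, z')"
  from A obtain As1 As2 where As: "As = As1 @ ?A # As2" by (meson split_list)
  from d have "derivable \<Sigma> (?x @ [word_fm (word z')] @ ?y @ \<Theta> @ map (Bang s) As) C"
    by (rule derivable_word_fm_left[OF word_neq_Nil])
  from LDivL[OF derivable_word_fm[OF word_neq_Nil[of z]] this]
  have "derivable \<Sigma> ((?x @ ?u) @ [?A] @ ?y @ \<Theta> @ map (Bang s) As) C" by simp
  from BangL[OF s(1) this]
  have "derivable \<Sigma> ((?x @ ?u) @ [Bang s ?A] @ (?y @ \<Theta> @ map (Bang s) As1) @ [Bang s ?A] @
      map (Bang s) As2) C" by (simp add: As)
  from Contr2[OF s(2) this] show ?thesis by (simp add: As)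
qed

lemma derivable_if_accepted:
  assumes s: "s \<in> labels \<Sigma>" "s \<in> contr \<Sigma>" and rs: "set rs = local_rules p"
    and acc: "step\<^sup>*\<^sup>* z accepted" and z: "z \<in> configs p"
  shows "derivable \<Sigma> (map atom (word z) @ cleanup_fm s (map rule_fm rs) #
    map (Bang s) (map rule_fm rs)) (atom (H Ok))"
  using acc z
proof (induction rule: converse_rtranclp_induct)
  case base
  have "set (map rule_fm rs) \<subseteq> formulae \<Sigma>" using rule_fm_formulae by auto
  from derivable_cleanup[OF s(1) this] show ?case by simp
next
  case (step z z')
  from step_local[OF step.hyps(1) step.prems] obtain a h b a' h' b' l r where
    "((a, h, b), (a', h', b')) \<in> local_rules p" and
    z: "z = (a @ l, h, b @ r)" and z': "z' = (a' @ l, h', b' @ r)" "z' \<in> configs p" .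
  then have "rule_fm ((a, h, b), (a', h', b')) \<in> set (map rule_fm rs)" using rs by force
  from derivable_rewrite[OF s this, of "map T (rev l)" "map T r" "[cleanup_fm s (map rule_fm rs)]"]
    step.IH[OF z'(2)]
  show ?case by (simp add: z z')
qed

section \<open>Soundness of the encoding\<close>

text \<open>Formulae denote sets of words closed downwards under syntactic approximation relative to a
  language \<open>G\<close>. A bang admits all structural rules here, so that the signature plays no role.\<close>

definition below :: "'a list set \<Rightarrow> 'a list \<Rightarrow> 'a list \<Rightarrow> bool" where
  "below G w v \<longleftrightarrow> (\<forall>x y. x @ v @ y \<in> G \<longrightarrow> x @ w @ y \<in> G)"

text \<open>A member of a bang can be erased, being below the empty word; the empty word as a member
  lets copies be inserted at no cost. Products are closed downwards explicitly, as plain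
  concatenations need not be.\<close>

primrec sem :: "'a list set \<Rightarrow> (nat \<Rightarrow> 'a list set) \<Rightarrow> 's fm \<Rightarrow> 'a list set" where
  "sem G v (Var n) = v n"
| "sem G v (Prod A B) = {w. \<exists>x\<in>sem G v A. \<exists>y\<in>sem G v B. below G w (x @ y)}"
| "sem G v (LDiv A B) = {w. \<forall>x\<in>sem G v A. x @ w \<in> sem G v B}"
| "sem G v (RDiv B A) = {w. \<forall>x\<in>sem G v A. w @ x \<in> sem G v B}"
| "sem G v (Bang s A) = {w. [] \<in> sem G v A \<and> below G w []}"

primrec sem_ctx :: "'a list set \<Rightarrow> (nat \<Rightarrow> 'a list set) \<Rightarrow> 's fm list \<Rightarrow> 'a list set" where
  "sem_ctx G v [] = {[]}"
| "sem_ctx G v (A # \<Gamma>) = {x @ y | x y. x \<in> sem G v A \<and> y \<in> sem_ctx G v \<Gamma>}"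

lemma below_refl: "below G w w"
  by (simp add: below_def)

lemma below_trans: "below G u v \<Longrightarrow> below G v w \<Longrightarrow> below G u w"
  by (simp add: below_def)

lemma below_context: "below G u v \<Longrightarrow> below G (x @ u @ y) (x @ v @ y)"
  unfolding below_def by (metis append.assoc)

lemma below_append: "below G u v \<Longrightarrow> below G u' v' \<Longrightarrow> below G (u @ u') (v @ v')"
  using below_context[of G u v "[]" u'] below_context[of G u' v' v "[]"]
  by (auto intro: below_trans)

lemma sem_ctx_append:
  "w \<in> sem_ctx G v (\<Gamma> @ \<Delta>) \<longleftrightarrow> (\<exists>x\<in>sem_ctx G v \<Gamma>. \<exists>y\<in>sem_ctx G v \<Delta>. w = x @ y)"
proof (induction \<Gamma> arbitrary: w)
  case (Cons A \<Gamma>)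
  show ?case by (auto simp: Cons) (metis append.assoc)+
qed simp

lemma sem_ctx_appendI:
  "x \<in> sem_ctx G v \<Gamma> \<Longrightarrow> y \<in> sem_ctx G v \<Delta> \<Longrightarrow> x @ y \<in> sem_ctx G v (\<Gamma> @ \<Delta>)"
  by (auto simp: sem_ctx_append)

lemma sem_down_closed:
  assumes "\<forall>n u w. w \<in> v n \<longrightarrow> below G u w \<longrightarrow> u \<in> v n"
  shows "w \<in> sem G v A \<Longrightarrow> below G u w \<Longrightarrow> u \<in> sem G v A"
proof (induction A arbitrary: u w)
  case (Var n)
  then show ?case using assms by auto
next
  case (LDiv A B)
  then show ?case using below_context[of G u w _ "[]"] by fastforce
next
  case (RDiv B A)
  then show ?case using below_context[of G u w "[]"] by fastforce
qed (auto intro: below_trans)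

text \<open>For contraction the additional copy is interpreted by the empty word. For weakening and
  exchange the word of the banged formula is erased by \<open>sem_down_closed\<close>; exchange then
  applies the induction hypothesis with the empty word in its place.\<close>

lemma derivable_sound:
  assumes v: "\<forall>n u w. w \<in> v n \<longrightarrow> below G u w \<longrightarrow> u \<in> v n"
  shows "derivable \<Sigma> \<Gamma> C \<Longrightarrow> w \<in> sem_ctx G v \<Gamma> \<Longrightarrow> w \<in> sem G v C"
proof (induction arbitrary: w rule: derivable.induct)
  case (ProdL \<Gamma>1 A B \<Gamma>2 C)
  then obtain x u y a b where w: "w = x @ u @ y" and
    "x \<in> sem_ctx G v \<Gamma>1" "y \<in> sem_ctx G v \<Gamma>2" "a \<in> sem G v A" "b \<in> sem G v B"
    and u: "below G u (a @ b)"
    by (auto simp: sem_ctx_append)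
  then have "x @ (a @ b) @ y \<in> sem G v C"
    by (intro ProdL.IH sem_ctx_appendI) auto
  then show ?case unfolding w using sem_down_closed[OF v] below_context[OF u] by blast
next
  case (ProdR \<Gamma>1 A \<Gamma>2 B)
  then show ?case using below_refl by (fastforce simp: sem_ctx_append)
next
  case (LDivL \<Pi> A \<Gamma>1 B \<Gamma>2 C)
  then obtain x u d y where w: "w = x @ (u @ d) @ y" and
    "x \<in> sem_ctx G v \<Gamma>1" "y \<in> sem_ctx G v \<Gamma>2" "u \<in> sem_ctx G v \<Pi>" "d \<in> sem G v (LDiv A B)"
    by (auto simp: sem_ctx_append simp del: sem.simps)
  moreover from this have "u @ d \<in> sem G v B" using LDivL.IH(1) by auto
  ultimately show ?case unfolding w by (intro LDivL.IH(2) sem_ctx_appendI) simp_all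
next
  case (LDivR A \<Pi> B)
  then show ?case by fastforce
next
  case (RDivL \<Pi> A \<Gamma>1 B \<Gamma>2 C)
  then obtain x u d y where w: "w = x @ (d @ u) @ y" and
    "x \<in> sem_ctx G v \<Gamma>1" "y \<in> sem_ctx G v \<Gamma>2" "u \<in> sem_ctx G v \<Pi>" "d \<in> sem G v (RDiv B A)"
    by (auto simp: sem_ctx_append simp del: sem.simps)
  moreover from this have "d @ u \<in> sem G v B" using RDivL.IH(1) by auto
  ultimately show ?case unfolding w by (intro RDivL.IH(2) sem_ctx_appendI) simp_all
next
  case (RDivR \<Pi> A B)
  then show ?case by (fastforce simp: sem_ctx_append)
next
  case (BangL s \<Gamma>1 A \<Gamma>2 C)
  then obtain x u y where w: "w = x @ u @ y" and
    "x \<in> sem_ctx G v \<Gamma>1" "y \<in> sem_ctx G v \<Gamma>2" "[] \<in> sem G v A" "below G u []"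
    by (auto simp: sem_ctx_append)
  moreover from this have "u \<in> sem G v A" using sem_down_closed[OF v] by blast
  ultimately show ?case unfolding w by (intro BangL.IH sem_ctx_appendI) simp_all
next
  case (BangR s \<Delta> B)
  \<comment> \<open>A context of banged formulae contains the empty word, and all its words are
    below that one; so the induction hypothesis is needed at the empty word only.\<close>
  have "below G w [] \<and> [] \<in> sem_ctx G v (map (\<lambda>(t, A). Bang t A) \<Delta>)"
    using BangR.prems
  proof (induction \<Delta> arbitrary: w)
    case (Cons tA \<Delta>)
    obtain t A where tA: "tA = (t, A)" by (cases tA)
    with Cons.prems obtain x y where w: "w = x @ y" and x: "below G x []" "[] \<in> sem G v A"
      and y: "y \<in> sem_ctx G v (map (\<lambda>(t, A). Bang t A) \<Delta>)" by auto
    from Cons.IH[OF y] x show ?case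
      using below_append[of G x "[]" y "[]"] by (simp add: w tA below_refl)
  qed (simp add: below_refl)
  then show ?case using BangR.IH by simp
next
  case (Weak s A \<Gamma>1 \<Gamma>2 C)
  then obtain x u y where w: "w = x @ u @ y" and
    "x \<in> sem_ctx G v \<Gamma>1" "y \<in> sem_ctx G v \<Gamma>2" and u: "below G u []"
    by (auto simp: sem_ctx_append)
  then have "x @ [] @ y \<in> sem G v C"
    by (intro Weak.IH sem_ctx_appendI) simp_all
  then show ?case unfolding w using sem_down_closed[OF v] below_context[OF u] by blast
next
  case (Contr1 s \<Gamma>1 A \<Delta> \<Gamma>2 C)
  then obtain x u d y where w: "w = x @ u @ d @ [] @ y" and
    "x \<in> sem_ctx G v \<Gamma>1" "y \<in> sem_ctx G v \<Gamma>2" "d \<in> sem_ctx G v \<Delta>" and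
    u: "u \<in> sem G v (Bang s A)"
    by (auto simp: sem_ctx_append)
  moreover from u have "[] \<in> sem G v (Bang s A)" by (auto simp: below_refl)
  ultimately show ?case unfolding w
    by (intro Contr1.IH sem_ctx_appendI) (simp_all del: sem.simps)
next
  case (Contr2 s \<Gamma>1 A \<Delta> \<Gamma>2 C)
  then obtain x u d y where w: "w = x @ [] @ d @ u @ y" and
    "x \<in> sem_ctx G v \<Gamma>1" "y \<in> sem_ctx G v \<Gamma>2" "d \<in> sem_ctx G v \<Delta>" and
    u: "u \<in> sem G v (Bang s A)"
    by (auto simp: sem_ctx_append)
  moreover from u have "[] \<in> sem G v (Bang s A)" by (auto simp: below_refl)
  ultimately show ?case unfolding w
    by (intro Contr2.IH sem_ctx_appendI) (simp_all del: sem.simps)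
next
  case (Exch1 s \<Gamma>1 \<Delta> A \<Gamma>2 C)
  then obtain x u d y where w: "w = x @ u @ d @ y" and
    xyd: "x \<in> sem_ctx G v \<Gamma>1" "y \<in> sem_ctx G v \<Gamma>2" "d \<in> sem_ctx G v \<Delta>" and
    u: "u \<in> sem G v (Bang s A)"
    by (auto simp: sem_ctx_append)
  from u have "[] \<in> sem G v (Bang s A)" "below G u []" by (auto simp: below_refl)
  with xyd have "x @ d @ [] @ y \<in> sem G v C"
    by (intro Exch1.IH sem_ctx_appendI) (simp_all del: sem.simps)
  then have "x @ [] @ d @ y \<in> sem G v C" by simp
  then show ?case unfolding w
    using sem_down_closed[OF v] below_context[OF \<open>below G u []\<close>] by blast
next
  case (Exch2 s \<Gamma>1 A \<Delta> \<Gamma>2 C)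
  then obtain x u d y where w: "w = (x @ d) @ u @ y" and
    xyd: "x \<in> sem_ctx G v \<Gamma>1" "y \<in> sem_ctx G v \<Gamma>2" "d \<in> sem_ctx G v \<Delta>" and
    u: "u \<in> sem G v (Bang s A)"
    by (auto simp: sem_ctx_append)
  from u have "[] \<in> sem G v (Bang s A)" "below G u []" by (auto simp: below_refl)
  with xyd have "x @ [] @ d @ y \<in> sem G v C"
    by (intro Exch2.IH sem_ctx_appendI) (simp_all del: sem.simps)
  then have "(x @ d) @ [] @ y \<in> sem G v C" by simp
  then show ?case unfolding w
    using sem_down_closed[OF v] below_context[OF \<open>below G u []\<close>] by blast
qed simp

section \<open>The model given by accepted configurations\<close>

definition accepting :: "letter list set" where
  "accepting = {word z | z. step\<^sup>*\<^sup>* z accepted}"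

text \<open>Each letter gets the principal ideal that it generates. An index that codes no letter
  gets the empty set, which is closed downwards as well.\<close>

definition valuation :: "nat \<Rightarrow> letter list set" where
  "valuation n = {w. \<exists>a. n = to_nat a \<and> below accepting w [a]}"

text \<open>Concatenation is monotone for \<open>below\<close>, so the product of the principal
  ideals of two words is the principal ideal of their concatenation.\<close>

lemma sem_word_fm:
  "u \<noteq> [] \<Longrightarrow> sem accepting valuation (word_fm u :: 's fm) = {w. below accepting w u}"
proof (induction u rule: word_fm.induct)
  case (3 a b w)
  then have IH: "sem accepting valuation (word_fm (b # w) :: 's fm) = {x. below accepting x (b # w)}" by simp
  show ?case
  proof (intro set_eqI iffI)
    fix x assume "x \<in> sem accepting valuation (word_fm (a # b # w) :: 's fm)"
    then obtain y z where "below accepting y [a]" "below accepting z (b # w)"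
      "below accepting x (y @ z)"
      by (auto simp: IH valuation_def )
    then show "x \<in> {x. below accepting x (a # b # w)}"
      using below_append below_trans by fastforce
  next
    fix x assume "x \<in> {x. below accepting x (a # b # w)}"
    then have "below accepting x ([a] @ (b # w))" by simp
    moreover have "[a] \<in> valuation (to_nat a)" by (auto simp: valuation_def below_refl)
    moreover have "b # w \<in> sem accepting valuation (word_fm (b # w) :: 's fm)" by (simp add: IH below_refl)
    ultimately show "x \<in> sem accepting valuation (word_fm (a # b # w) :: 's fm)"
      unfolding word_fm.simps sem.simps by blast
  qed
qed (auto simp: valuation_def)

text \<open>The right-hand side has exactly one head letter, so the two head positions coincide, and
  the contexts \<open>x\<close> and \<open>y\<close> can only consist of tape letters.\<close>

lemma unique_head:
  assumes "x @ map T a @ H h # map T b @ y = map T l @ H h' # map T r"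
  obtains x' y' where "x = map T x'" "y = map T y'" "h = h'" "l = x' @ a" "r = b @ y'"
proof -
  have tape: "\<exists>l'. w = map T l'" if "set w \<subseteq> range T" for w
    using that by (metis ex_map_conv image_iff subset_eq)
  have "length (x @ map T a) = length l"
  proof (rule ccontr)
    assume neq: "length (x @ map T a) \<noteq> length l"
    let ?w = "map T l @ H h' # map T r"
    have "?w ! length (x @ map T a) = H h"
      by (subst assms[symmetric]) (simp add: nth_append)
    moreover have "length (x @ map T a) < length ?w" by (subst assms[symmetric]) simp
    ultimately show False using neq
      by (auto simp: nth_append nth_Cons' split: if_splits)
  qed
  then have eq: "x @ map T a = map T l" "h = h'" "map T b @ y = map T r"
    using assms append_eq_append_conv[of "x @ map T a" "map T l"] by auto
  have "set (x @ map T a) \<subseteq> range T" "set (map T b @ y) \<subseteq> range T" unfolding eq by auto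
  with tape obtain x' y' where "x = map T x'" "y = map T y'" by force
  moreover from this eq have "map T (x' @ a) = map T l" "map T (b @ y') = map T r" by auto
  then have "x' @ a = l" "b @ y' = r" by (meson inj_map_eq_map injI letter.inject(1))+
  ultimately show thesis using that eq(2) by metis
qed

text \<open>\<open>below\<close> ranges over arbitrary contexts, but one that completes
  \<open>word z'\<close> to an accepting word contains no second head. It is tape around the redex,
  and the rule gives one more step at the front of the accepting computation.\<close>

lemma rule_below:
  assumes "rule z z'"
  shows "below accepting (word z) (word z')"
  unfolding below_def
proof (intro allI impI)
  fix x y assume acc: "x @ word z' @ y \<in> accepting"
  obtain a h b a' h' b' where z: "z = (a, h, b)" and z': "z' = (a', h', b')" by (cases z, cases z')
  from acc obtain l k r where w: "x @ map T (rev a') @ H h' # map T b' @ y = map T (rev l) @ H k # map T r"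
    and steps: "step\<^sup>*\<^sup>* (l, k, r) accepted"
    by (auto simp: accepting_def z')
  from unique_head[OF w] obtain x' y' where xy: "x = map T x'" "y = map T y'"
    and "h' = k" "rev l = x' @ rev a'" "r = b' @ y'" by blast
  moreover from this have "l = a' @ rev x'" by (metis rev_append rev_rev_ident)
  ultimately have "step\<^sup>*\<^sup>* (a @ rev x', h, b @ y') accepted"
    using steps stepI[OF assms[unfolded z z'], of "rev x'" y']
    by (auto intro: converse_rtranclp_into_rtranclp)
  moreover have "x @ word z @ y = word (a @ rev x', h, b @ y')" by (simp add: z xy)
  ultimately show "x @ word z @ y \<in> accepting" unfolding accepting_def by blast
qed

text \<open>The empty word belongs to a division exactly if the divisor is contained in the
  dividend; for principal ideals this follows from \<open>rule_below\<close>.\<close>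

lemma sem_rule_fm: "rule x y \<Longrightarrow> [] \<in> sem accepting valuation (rule_fm (x, y) :: 's fm)"
  using rule_below[of x y]
  by (auto simp: sem_word_fm[OF word_neq_Nil] simp del: word.simps intro: below_trans)

lemma sem_ctx_atoms: "w \<in> sem_ctx accepting valuation (map atom w :: 's fm list)"
proof (induction w)
  case (Cons a w)
  have "[a] \<in> sem_ctx accepting valuation [atom a :: 's fm]" by (auto simp: valuation_def below_refl)
  from sem_ctx_appendI[OF this Cons] show ?case by simp
qed simp

lemma sem_ctx_bang:
  "\<forall>A\<in>set As. [] \<in> sem G v A \<Longrightarrow> [] \<in> sem_ctx G v (map (Bang s) As)"
  by (induction As) (auto simp: below_refl)

text \<open>Words of a bang are below the empty word, so appending them keeps a word below
  \<open>[H Ok]\<close>, whatever the formulae under the bangs are.\<close>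

lemma sem_cleanup_fm: "[] \<in> sem accepting valuation (cleanup_fm s As)"
proof -
  have "w \<in> sem accepting valuation (foldr (\<lambda>A B. RDiv B (Bang s A)) As (atom (H Ok)))"
    if "below accepting w [H Ok]" for w
    using that
  proof (induction As arbitrary: w)
    case (Cons A As)
    then show ?case using below_append[of accepting w "[H Ok]" _ "[]"] by auto
  qed (auto simp: valuation_def)
  then show ?thesis by (auto simp: cleanup_fm_def valuation_def)
qed

text \<open>All formulae after the word are interpreted by the empty word, so soundness puts
  \<open>word z\<close> below \<open>[H Ok]\<close>, the word of \<open>accepted\<close>. In the
  empty context this says that \<open>word z\<close> is in \<open>accepting\<close>.\<close>

lemma accepted_if_derivable:
  assumes d: "derivable \<Sigma> (map atom (word z) @ cleanup_fm s (map rule_fm rs) #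
      map (Bang s) (map rule_fm rs)) (atom (H Ok))" (is "derivable \<Sigma> ?\<Gamma> ?C")
    and rs: "\<And>x y. (x, y) \<in> set rs \<Longrightarrow> rule x y"
  shows "step\<^sup>*\<^sup>* z accepted"
proof -
  have "\<forall>A::'a fm\<in>set (map rule_fm rs). [] \<in> sem accepting valuation A"
  proof
    fix A :: "'a fm" assume "A \<in> set (map rule_fm rs)"
    then obtain x y where "A = rule_fm (x, y)" "(x, y) \<in> set rs" by force
    then show "[] \<in> sem accepting valuation A" using sem_rule_fm[OF rs] by blast
  qed
  note bangs = sem_ctx_bang[OF this, of s]
  have "[] \<in> sem_ctx accepting valuation [cleanup_fm s (map rule_fm rs)]"
    using sem_cleanup_fm[of s "map rule_fm rs"] by simp
  from sem_ctx_appendI[OF sem_ctx_atoms sem_ctx_appendI[OF this bangs], of "word z"]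
  have "word z \<in> sem_ctx accepting valuation ?\<Gamma>" unfolding append.simps append_Nil2 .
  moreover have "\<forall>n u w. w \<in> valuation n \<longrightarrow> below accepting u w \<longrightarrow> u \<in> valuation n"
    by (auto simp: valuation_def intro: below_trans)
  ultimately have "word z \<in> sem accepting valuation ?C" using derivable_sound[OF _ d] by blast
  then have "below accepting (word z) [H Ok]" by (auto simp: valuation_def)
  moreover have "word accepted \<in> accepting" unfolding accepting_def by blast
  ultimately have "word z \<in> accepting"
    unfolding below_def by (metis append.left_neutral append.right_neutral list.map(1) rev.simps(1) word.simps)
  then obtain z' where z': "word z = word z'" "step\<^sup>*\<^sup>* z' accepted" unfolding accepting_def by blast
  obtain l h r l' h' r' where zz: "z = (l, h, r)" "z' = (l', h', r')" by (cases z, cases z')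
  have "[] @ map T (rev l) @ H h # map T r @ [] = map T (rev l') @ H h' # map T r'"
    using z'(1) zz by simp
  from unique_head[OF this] have "z = z'" by (auto simp: zz)
  with z' show ?thesis by simp
qed

section \<open>The code of the diagonal instance is computable\<close>

fun const_recf :: "nat \<Rightarrow> recf" where
  "const_recf 0 = Zero"
| "const_recf (Suc n) = Comp Succ [const_recf n]"

definition add_recf :: recf where
  "add_recf = PrimRec (Proj 0) (Comp Succ [Proj 1])"

definition triangle_recf :: recf where
  "triangle_recf = PrimRec Zero (Comp add_recf [Proj 1, Comp Succ [Proj 0]])"

definition pair_recf :: recf where
  "pair_recf = Comp add_recf [Comp triangle_recf [add_recf], Proj 0]"

text \<open>\<open>list_encode\<close> codes a nonempty list as the successor of the pair of the
  head and the code of the tail.\<close>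

definition cons_recf :: "nat \<Rightarrow> recf" where
  "cons_recf a = Comp Succ [Comp pair_recf [const_recf a, Proj 0]]"

definition cons_power_recf :: "nat \<Rightarrow> recf" where
  "cons_power_recf a = PrimRec (Proj 0) (Comp (cons_recf a) [Proj 1])"

lemma rec_eval_Proj: "i < length xs \<Longrightarrow> y = xs ! i \<Longrightarrow> rec_eval (Proj i) xs y"
  by (simp add: rec_Proj)

lemma rec_eval_Comp1: "rec_eval g xs y \<Longrightarrow> rec_eval f [y] z \<Longrightarrow> rec_eval (Comp f [g]) xs z"
  by (rule rec_Comp[of xs _ "[y]"]) auto

lemma rec_eval_Comp2:
  "rec_eval g xs y \<Longrightarrow> rec_eval g' xs y' \<Longrightarrow> rec_eval f [y, y'] z \<Longrightarrow> rec_eval (Comp f [g, g']) xs z"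
  by (rule rec_Comp[of xs _ "[y, y']"]) auto

lemma rec_eval_const: "rec_eval (const_recf n) xs n"
  by (induction n) (auto intro: rec_Zero rec_Succ rec_eval_Comp1)

lemma rec_eval_add: "rec_eval add_recf [m, n] (m + n)"
  unfolding add_recf_def
proof (induction m)
  case 0
  show ?case by (rule rec_PrimRec_0) (auto intro: rec_eval_Proj)
next
  case (Suc m)
  then show ?case
    by (rule rec_PrimRec_Suc) (auto intro!: rec_eval_Comp1[of _ _ "m + n"] rec_eval_Proj rec_Succ)
qed

lemma rec_eval_triangle: "rec_eval triangle_recf [n] (triangle n)"
  unfolding triangle_recf_def
proof (induction n)
  case 0
  show ?case using rec_PrimRec_0[OF rec_Zero] by simp
next
  case (Suc n)
  have "rec_eval (Comp add_recf [Proj 1, Comp Succ [Proj 0]]) [n, triangle n] (triangle (Suc n))"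
    using rec_eval_add[of "triangle n" "Suc n"]
    by (intro rec_eval_Comp2[of _ _ "triangle n" _ "Suc n"] rec_eval_Comp1[of _ _ n] rec_eval_Proj rec_Succ) auto
  with Suc show ?case by (rule rec_PrimRec_Suc)
qed

lemma rec_eval_pair: "rec_eval pair_recf [m, n] (prod_encode (m, n))"
  unfolding pair_recf_def prod_encode_def
  by (auto intro!: rec_eval_Comp2[of _ _ "triangle (m + n)" _ m] rec_eval_Comp1[of _ _ "m + n"]
    rec_eval_add rec_eval_triangle rec_eval_Proj)

lemma rec_eval_cons: "rec_eval (cons_recf a) [n] (Suc (prod_encode (a, n)))"
  unfolding cons_recf_def
  by (intro rec_eval_Comp1[OF rec_eval_Comp2[OF rec_eval_const rec_eval_Proj rec_eval_pair] rec_Succ]) auto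

lemma rec_eval_cons_power:
  "rec_eval (cons_power_recf a) [n, list_encode xs] (list_encode (replicate n a @ xs))"
  unfolding cons_power_recf_def
proof (induction n)
  case 0
  show ?case by (rule rec_PrimRec_0) (auto intro: rec_eval_Proj)
next
  case (Suc n)
  then show ?case
  proof (rule rec_PrimRec_Suc)
    show "rec_eval (Comp (cons_recf a) [Proj 1])
      [n, list_encode (replicate n a @ xs), list_encode xs] (list_encode (replicate (Suc n) a @ xs))"
      using rec_eval_cons[of a "list_encode (replicate n a @ xs)"]
      by (intro rec_eval_Comp1[OF rec_eval_Proj]) auto
  qed
qed

text \<open>The input is used twice, as the number of input letters and as the code of the tail of
  the antecedent. The numbering of the labels enters only through the latter, so the function itself
  does not mention it.\<close>

definition diagonal_recf :: recf where
  "diagonal_recf = Comp pair_recf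
    [Comp (cons_recf (prod_encode (0, to_nat (T Lft))))
      [Comp (cons_power_recf (prod_encode (0, to_nat (T (Reg 0))))) [Proj 0, Proj 0]],
     const_recf (prod_encode (0, to_nat (H Ok)))]"

lemma rec_eval_diagonal:
  fixes \<Gamma> :: "'s fm list"
  assumes "n = list_encode (map (fm_encode l) \<Gamma>)"
  shows "rec_eval diagonal_recf [n]
    (sequent_encode l (atom (T Lft) # replicate n (atom (T (Reg 0))) @ \<Gamma>, atom (H Ok)))"
proof -
  let ?xs = "replicate n (prod_encode (0, to_nat (T (Reg 0)))) @ map (fm_encode l) \<Gamma>"
  have "rec_eval (Comp (cons_power_recf (prod_encode (0, to_nat (T (Reg 0))))) [Proj 0, Proj 0]) [n]
      (list_encode ?xs)"
    using rec_eval_cons_power[of _ n "map (fm_encode l) \<Gamma>"]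
    by (intro rec_eval_Comp2[of _ _ n _ n] rec_eval_Proj) (auto simp flip: assms)
  from rec_eval_Comp2[OF rec_eval_Comp1[OF this rec_eval_cons] rec_eval_const rec_eval_pair]
  show ?thesis unfolding diagonal_recf_def by (simp add: sequent_encode_def)
qed

section \<open>The diagonal argument\<close>

theorem theorem6:
  fixes \<Sigma> :: "'s subexp_sig"
  assumes "subexp_signature \<Sigma>" and "contr \<Sigma> \<noteq> {}"
  shows "\<not> decidable_derivability \<Sigma>"
proof
  assume "decidable_derivability \<Sigma>"
  then obtain l f where f: "(\<Gamma>, C) \<in> sequents \<Sigma> \<Longrightarrow>
      rec_eval f [sequent_encode l (\<Gamma>, C)] (if derivable \<Sigma> \<Gamma> C then 1 else 0)" for \<Gamma> C
    unfolding decidable_derivability_def decidable_problem_def by fastforce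
  obtain s where s: "s \<in> contr \<Sigma>" "s \<in> labels \<Sigma>"
    using assms unfolding subexp_signature_def up_closed_def by blast
  obtain p where p: "\<And>n y. rec_eval (Comp f [diagonal_recf]) [n] y \<Longrightarrow>
      run p (\<lambda>i. if i = 0 then n else 0) ((\<lambda>_. 0)(0 := n, 1 := y))"
    using compile_unary by blast
  obtain rs where rs: "set rs = local_rules p" using finite_list[OF finite_local_rules] by blast
  define As :: "'s fm list" where "As = map rule_fm rs"
  define \<Theta> where "\<Theta> = [atom (H (Back p)), atom (T Rgt)] @ cleanup_fm s As # map (Bang s) As"
  \<comment> \<open>There is no circularity: \<open>p\<close> is compiled for all inputs and
    determines \<open>\<Theta>\<close>, and only then is the input chosen as the code of
    \<open>\<Theta>\<close>. At this input the diagonal function yields the code of the sequent for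
    \<open>start p n\<close>.\<close>
  define n where "n = list_encode (map (fm_encode l) \<Theta>)"
  define \<Gamma> where "\<Gamma> = atom (T Lft) # replicate n (atom (T (Reg 0))) @ \<Theta>"
  have As: "set As \<subseteq> formulae \<Sigma>" unfolding As_def using rule_fm_formulae by auto
  have "(\<Gamma>, atom (H Ok)) \<in> sequents \<Sigma>"
    using As s(2) cleanup_fm_formulae[OF s(2) As]
    unfolding \<Gamma>_def \<Theta>_def sequents_def formulae_def by fastforce
  from rec_eval_Comp1[OF rec_eval_diagonal[OF n_def] f[OF this, unfolded \<Gamma>_def]]
  have "rec_eval (Comp f [diagonal_recf]) [n] (if derivable \<Sigma> \<Gamma> (atom (H Ok)) then 1 else 0)"
    by (simp add: \<Gamma>_def)
  \<comment> \<open>Acceptance means output 0, which is the answer of the decider for a sequent that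
    is not derivable.\<close>
  from start_accepts_iff[OF p[OF this]]
  have "step\<^sup>*\<^sup>* (start p n) accepted \<longleftrightarrow> \<not> derivable \<Sigma> \<Gamma> (atom (H Ok))" by simp
  moreover have "\<Gamma> = map atom (word (start p n)) @ cleanup_fm s As # map (Bang s) As"
    by (simp add: \<Gamma>_def \<Theta>_def)
  then have "step\<^sup>*\<^sup>* (start p n) accepted \<longleftrightarrow> derivable \<Sigma> \<Gamma> (atom (H Ok))"
    using derivable_if_accepted[OF s(2,1) rs _ start_configs] accepted_if_derivable[of \<Sigma> "start p n" s rs] rs
    unfolding As_def by (auto simp: local_rules_def)
  ultimately show False by blast
qed

end
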